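(* Let $c\ge 1$, $\lambda>0$, and let $G$ be a service-duration distribution on $(0,\infty)$, with $S\sim G$, $\mathbb{E}[S^2]<\infty$ and $\rho=\lambda\,\mathbb{E}[S]<c$. Let $T'<T<0$, and let $L_{[T,0]}$ and $L_{[T',0]}$ (respectively $U_{[T,0]}$ and $U_{[T',0]}$) be the lower (respectively upper) sandwiching processes started at times $T$ and $T'$, constructed from the same realization of the dominating process $\hat Y$ as described in the context. Then for all times $t\in[T,0]$, $$L_{[T,0]}(t)\ \trianglelefteq\ L_{[T',0]}(t)\ \trianglelefteq\ U_{[T',0]}(t)\ \trianglelefteq\ U_{[T,0]}(t),$$ where $\trianglelefteq$ denotes coordinate-wise domination of the Kiefer–Wolfowitz workload vectors.
   Context: **Queues.** In a $c$-server first-come-first-served ($FCFS$) queue customers are served in order of arrival, each starting service as soon as a server is free for it. Its Kiefer–Wolfowitz workload vector $\mathbf V(t)=(V(1,t)\le\dots\le V(c,t))$ is the increasingly ordered vector of residual work at the $c$ servers: an arriving customer adds its service duration to the smallest coordinate and the vector is then re-sorted; between arrivals each coordinate decreases at unit rate until it reaches $0$; it is taken right-continuous. $\mathbf V\trianglelefteq\tilde{\mathbf V}$ means $V(i)\le\tilde V(i)$ for $i=1,\dots,c$. Under processor sharing ($PS$), a single server serves all customers present simultaneously, each at rate $1/(\text{number of customers present})$. **Dominating process.** Let $\hat Y=(\hat Y_1,\dots,\hat Y_c)$ be a stationary system of $c$ independent $M_{\lambda/c}/G/1$ $[PS]$ queues (arrival rate $\lambda/c$, service durations of law $G$), run over reversed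 time $\hat t\ge0$; the state records the full and residual service duration of each customer. Given $T<0$ and $\hat T=-T$, put $\hat\tau_j=\inf\{\hat t\ge\hat T:\hat Y_j\text{ is empty at }\hat t\}$ and $\tau_j=-\hat\tau_j\le T$. For each $j$ let $Y_j$ be the single-server $FCFS$ queue started empty at time $\tau_j$, with a customer arriving at time $-\hat t$, carrying service duration $s$, for each departure from $\hat Y_j$ at a reversed time $\hat t\in[0,\hat\tau_j]$ of a customer with full service duration $s$. Let $t^+\ge 0$ be a time by which all customers present in $Y=(Y_1,\dots,Y_c)$ at time $0$ have initiated service; extend each $Y_j$ over $(0,t^+]$ using independent further Poisson arrivals of rate $\lambda/c$ with i.i.d. service durations of law $G$. The same $\hat Y$ and the same extension over $(0,t^+]$ are used for all values of $T$. **Lists.** Order the union over $j$ of all arrival times of $Y_j$ in $[\tau_j,0]$ as $t_1\le t_2\le\dots\le t_n$. Order the union over $j$ of all pairs $(J,S)$ (time $J$ of initiation of a service and its service duration $S$) of $Y_j$ over $[\tau_j,t^+]$ by increasing $J$, as $(J_1,S_1),(J_2,S_2),\dots$. Form the triples $(t_k,J_k,S_k)$, $k=1,\dots,n$. Let $\mathcal L_T^*$ be the list of triples with $t_k\le T$ and $\mathcal L_T$ the list of triples with $t_k>T$. Replace each triple in $\mathcal L_T^*$ by $(T,\,J_k\vee T,\,R_k)$, where $R_k=(J_k+S_k)\vee T-(J_k\vee T)$. **Upper and lower processes.** $U_{[T,0]}$ is the $c$-server $FCFS$ queue over $[T,0]$ started empty at time $T$, fed in order with the arrival times and service durations read first from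 $\mathcal L_T^*$ (arrival time $T$, service duration $R_k$) and then from $\mathcal L_T$ (arrival time $t_k$, service duration $S_k$). $L_{[T,0]}$ is constructed in the same way, but with all service durations in $\mathcal L_T^*$ set to zero. The processes $U_{[T',0]}$, $L_{[T',0]}$ are obtained by the same construction with $T'$ in place of $T$. *)

theory Defs
  imports "HOL-Probability.Probability"
begin

text \<open>
  Vectors of residual work are increasingly ordered lists whose length is the number of servers.
\<close>

definition kw_dominated :: "real list \<Rightarrow> real list \<Rightarrow> bool"  (infix "\<unlhd>" 50) where
  "v \<unlhd> w \<longleftrightarrow> length v = length w \<and> (\<forall>i < length v. v ! i \<le> w ! i)"

definition kw_drain :: "real \<Rightarrow> real list \<Rightarrow> real list" where
  "kw_drain d v = map (\<lambda>x. max 0 (x - d)) v"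

fun kw_arrive :: "real \<Rightarrow> real list \<Rightarrow> real list" where
  "kw_arrive s [] = []"
| "kw_arrive s (x # xs) = sort ((x + s) # xs)"

text \<open>
  \<open>kw_workload u v as t\<close> is the workload at time \<open>t \<ge> u\<close> of a first-come-first-served queue in
  state \<open>v\<close> at time \<open>u\<close>, fed in order with the pairs (arrival time, service duration) in \<open>as\<close>. The
  arrival times must increase weakly and be at least \<open>u\<close>. An arrival at \<open>t\<close> is included, which
  makes the path right-continuous.
\<close>

fun kw_workload :: "real \<Rightarrow> real list \<Rightarrow> (real \<times> real) list \<Rightarrow> real \<Rightarrow> real list" where
  "kw_workload u v [] t = kw_drain (t - u) v"
| "kw_workload u v ((a, s) # as) t =
     (if a \<le> t then kw_workload a (kw_arrive s (kw_drain (a - u) v)) as t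
      else kw_drain (t - u) v)"

text \<open>
  Pairs (time of initiation of service, service duration) of a single-server
  first-come-first-served queue whose server is free from time \<open>f\<close> on.
\<close>

fun fcfs_starts :: "real \<Rightarrow> (real \<times> real) list \<Rightarrow> (real \<times> real) list" where
  "fcfs_starts f [] = []"
| "fcfs_starts f ((a, s) # as) = (max a f, s) # fcfs_starts (max a f + s) as"


text \<open>
  The data of one processor-sharing queue over reversed time. At reversed time 0 it contains
  \<open>init_num\<close> customers, the \<open>i\<close>-th having (full, residual) service durations \<open>init_cust i\<close>;
  entries with \<open>i \<ge> init_num\<close> are ignored. The fields \<open>gap\<close> and \<open>dur\<close> are the interarrival times and
  service durations of the customers arriving at reversed times \<open>> 0\<close>; \<open>ext_gap\<close> and \<open>ext_dur\<close> are
  those of the customers added to the time-reversed queue after (forward) time 0.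
\<close>

record queue_input =
  init_num :: nat
  init_cust :: "nat \<Rightarrow> real \<times> real"
  gap :: "nat \<Rightarrow> real"
  dur :: "nat \<Rightarrow> real"
  ext_gap :: "nat \<Rightarrow> real"
  ext_dur :: "nat \<Rightarrow> real"

text \<open>Customers are numbered, first the initial ones and then the others in order of arrival.\<close>

definition entry :: "queue_input \<Rightarrow> nat \<Rightarrow> real" where
  "entry q i = (if i < init_num q then 0 else (\<Sum>k\<le>i - init_num q. gap q k))"

definition full :: "queue_input \<Rightarrow> nat \<Rightarrow> real" where
  "full q i = (if i < init_num q then fst (init_cust q i) else dur q (i - init_num q))"

definition entry_residual :: "queue_input \<Rightarrow> nat \<Rightarrow> real" where
  "entry_residual q i = (if i < init_num q then snd (init_cust q i) else dur q (i - init_num q))"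

text \<open>In the following, \<open>r i t\<close> is the residual service duration of customer \<open>i\<close> at reversed time \<open>t\<close>.\<close>

definition present :: "queue_input \<Rightarrow> (nat \<Rightarrow> real \<Rightarrow> real) \<Rightarrow> real \<Rightarrow> nat set" where
  "present q r t = {i. entry q i \<le> t \<and> 0 < r i t}"

text \<open>
  Processor sharing in integrated form: customer \<open>i\<close> starts with residual \<open>entry_residual q i\<close> and,
  while present, is served at rate 1/(number of customers present).
\<close>

definition processor_sharing :: "queue_input \<Rightarrow> (nat \<Rightarrow> real \<Rightarrow> real) \<Rightarrow> bool" where
  "processor_sharing q r \<longleftrightarrow>
     (\<forall>i. \<forall>t \<ge> entry q i.
        ((\<lambda>u. if 0 < r i u then 1 / real (card (present q r u)) else 0)
           has_integral (entry_residual q i - r i t)) {entry q i..t})"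

definition ps_state :: "queue_input \<Rightarrow> (nat \<Rightarrow> real \<Rightarrow> real) \<Rightarrow> real \<Rightarrow> (real \<times> real) multiset" where
  "ps_state q r t = image_mset (\<lambda>i. (full q i, r i t)) (mset_set (present q r t))"

definition departure :: "queue_input \<Rightarrow> (nat \<Rightarrow> real \<Rightarrow> real) \<Rightarrow> nat \<Rightarrow> real" where
  "departure q r i = Inf {t. entry q i \<le> t \<and> r i t = 0}"


text \<open>The \<open>\<sigma>\<close>-algebra on configurations is generated by the numbers of points in Borel sets.\<close>

definition config_space :: "(real \<times> real) multiset measure" where
  "config_space = sigma UNIV
     {{X. size (filter_mset (\<lambda>x. x \<in> B) X) = n} | B n. B \<in> sets borel}"

definition stationary_process ::
    "'w measure \<Rightarrow> 's measure \<Rightarrow> 'i set \<Rightarrow> ('i \<Rightarrow> real \<Rightarrow> 'w \<Rightarrow> 's) \<Rightarrow> bool" where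
  "stationary_process M N I X \<longleftrightarrow>
     (\<forall>i\<in>I. \<forall>t\<ge>0. X i t \<in> measurable M N) \<and>
     (\<forall>h\<ge>0. distr M (PiM (I \<times> {0..}) (\<lambda>_. N)) (\<lambda>\<omega>. \<lambda>(i, t)\<in>I \<times> {0..}. X i (t + h) \<omega>)
           = distr M (PiM (I \<times> {0..}) (\<lambda>_. N)) (\<lambda>\<omega>. \<lambda>(i, t)\<in>I \<times> {0..}. X i t \<omega>))"

datatype source =
    Init (queue_of: nat)
  | Gap (queue_of: nat) nat
  | Dur (queue_of: nat) nat
  | Ext_Gap (queue_of: nat) nat
  | Ext_Dur (queue_of: nat) nat

definition init_space :: "(nat \<times> (nat \<Rightarrow> real \<times> real)) measure" where
  "init_space = count_space UNIV \<Otimes>\<^sub>M PiM UNIV (\<lambda>_. borel)"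

definition init_state :: "queue_input \<Rightarrow> nat \<times> (nat \<Rightarrow> real \<times> real)" where
  "init_state q = (init_num q, init_cust q)"

fun source_events :: "'w measure \<Rightarrow> (nat \<Rightarrow> 'w \<Rightarrow> queue_input) \<Rightarrow> source \<Rightarrow> 'w set set" where
  "source_events M Q (Init j) = sets (vimage_algebra (space M) (\<lambda>\<omega>. init_state (Q j \<omega>)) init_space)"
| "source_events M Q (Gap j k) = sets (vimage_algebra (space M) (\<lambda>\<omega>. gap (Q j \<omega>) k) borel)"
| "source_events M Q (Dur j k) = sets (vimage_algebra (space M) (\<lambda>\<omega>. dur (Q j \<omega>) k) borel)"
| "source_events M Q (Ext_Gap j k) = sets (vimage_algebra (space M) (\<lambda>\<omega>. ext_gap (Q j \<omega>) k) borel)"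
| "source_events M Q (Ext_Dur j k) = sets (vimage_algebra (space M) (\<lambda>\<omega>. ext_dur (Q j \<omega>) k) borel)"

text \<open>
  Here \<open>r j i t \<omega>\<close> is the residual service duration at reversed time \<open>t\<close> of customer \<open>i\<close> in queue
  \<open>j < c\<close>. Poisson arrivals are given by independent exponential interarrival times.
\<close>

locale dominating_process = prob_space M
  for M :: "'w measure" and c :: nat and lam :: real and G :: "real measure"
    and Q :: "nat \<Rightarrow> 'w \<Rightarrow> queue_input"
    and r :: "nat \<Rightarrow> nat \<Rightarrow> real \<Rightarrow> 'w \<Rightarrow> real" +
  assumes init_measurable: "j < c \<Longrightarrow> (\<lambda>\<omega>. init_state (Q j \<omega>)) \<in> measurable M init_space"
    and init_residual: "j < c \<Longrightarrow> AE \<omega> in M. \<forall>i < init_num (Q j \<omega>).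
          0 < snd (init_cust (Q j \<omega>) i) \<and> snd (init_cust (Q j \<omega>) i) \<le> fst (init_cust (Q j \<omega>) i)"
    and gap_law:
      "j < c \<Longrightarrow> distributed M lborel (\<lambda>\<omega>. gap (Q j \<omega>) k) (exponential_density (lam / real c))"
    and dur_measurable: "j < c \<Longrightarrow> (\<lambda>\<omega>. dur (Q j \<omega>) k) \<in> borel_measurable M"
    and dur_law: "j < c \<Longrightarrow> distr M borel (\<lambda>\<omega>. dur (Q j \<omega>) k) = G"
    and ext_gap_law:
      "j < c \<Longrightarrow> distributed M lborel (\<lambda>\<omega>. ext_gap (Q j \<omega>) k) (exponential_density (lam / real c))"
    and ext_dur_measurable: "j < c \<Longrightarrow> (\<lambda>\<omega>. ext_dur (Q j \<omega>) k) \<in> borel_measurable M"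
    and ext_dur_law: "j < c \<Longrightarrow> distr M borel (\<lambda>\<omega>. ext_dur (Q j \<omega>) k) = G"
    and independent: "indep_sets (source_events M Q) {x. queue_of x < c}"
    and ps_dynamics: "j < c \<Longrightarrow> AE \<omega> in M. processor_sharing (Q j \<omega>) (\<lambda>i t. r j i t \<omega>)"
    and stationary: "stationary_process M config_space {..<c}
          (\<lambda>j t \<omega>. ps_state (Q j \<omega>) (\<lambda>i u. r j i u \<omega>) t)"


definition tau_hat :: "queue_input \<Rightarrow> (nat \<Rightarrow> real \<Rightarrow> real) \<Rightarrow> real \<Rightarrow> real" where
  "tau_hat q r T = Inf {t. - T \<le> t \<and> present q r t = {}}"

text \<open>
  Pairs (arrival time, service duration) of the time-reversed queue, in order of arrival: first those
  over \<open>[- tau_hat q r T, 0]\<close>, then those over \<open>(0, t\<^sup>+]\<close>.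
\<close>

definition reversed_arrivals ::
    "queue_input \<Rightarrow> (nat \<Rightarrow> real \<Rightarrow> real) \<Rightarrow> real \<Rightarrow> (real \<times> real) list" where
  "reversed_arrivals q r T =
     map (\<lambda>i. (- departure q r i, full q i))
       (sort_key (\<lambda>i. - departure q r i)
         (sorted_list_of_set {i. \<exists>t. entry q i \<le> t \<and> t \<le> tau_hat q r T \<and> r i t = 0}))"

definition ext_time :: "queue_input \<Rightarrow> nat \<Rightarrow> real" where
  "ext_time q k = (\<Sum>l\<le>k. ext_gap q l)"

definition ext_arrivals :: "queue_input \<Rightarrow> real \<Rightarrow> (real \<times> real) list" where
  "ext_arrivals q tp =
     map (\<lambda>k. (ext_time q k, ext_dur q k)) (sorted_list_of_set {k. ext_time q k \<le> tp})"

definition initiations ::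
    "queue_input \<Rightarrow> (nat \<Rightarrow> real \<Rightarrow> real) \<Rightarrow> real \<Rightarrow> real \<Rightarrow> (real \<times> real) list" where
  "initiations q r T tp =
     filter (\<lambda>(J, S). J \<le> tp)
       (fcfs_starts (- tau_hat q r T) (reversed_arrivals q r T @ ext_arrivals q tp))"

text \<open>
  \<open>tp \<ge> 0\<close> is a time by which all customers present at time 0 in the time-reversed queues have
  initiated service. Such a customer arrives at or before time 0 and leaves at \<open>J + S > 0\<close>.
\<close>

definition initiated_by ::
    "nat \<Rightarrow> (nat \<Rightarrow> queue_input) \<Rightarrow> (nat \<Rightarrow> nat \<Rightarrow> real \<Rightarrow> real) \<Rightarrow> real \<Rightarrow> real \<Rightarrow> bool" where
  "initiated_by c q r T tp \<longleftrightarrow> 0 \<le> tp \<and>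
     (\<forall>j<c. \<forall>(J, S) \<in> set (fcfs_starts (- tau_hat (q j) (r j) T) (reversed_arrivals (q j) (r j) T)).
        0 < J + S \<longrightarrow> J \<le> tp)"

text \<open>
  The triples \<open>(t\<^sub>k, J\<^sub>k, S\<^sub>k)\<close>; \<open>zip\<close> keeps the first \<open>n\<close> of the pairs \<open>(J, S)\<close>, where \<open>n\<close> is the
  number of arrivals, since there are at least \<open>n\<close> such pairs if \<open>initiated_by c q r T tp\<close>.
\<close>

definition triples ::
    "nat \<Rightarrow> (nat \<Rightarrow> queue_input) \<Rightarrow> (nat \<Rightarrow> nat \<Rightarrow> real \<Rightarrow> real) \<Rightarrow> real \<Rightarrow> real
       \<Rightarrow> (real \<times> real \<times> real) list" where
  "triples c q r T tp =
     zip (sort (concat (map (\<lambda>j. map fst (reversed_arrivals (q j) (r j) T)) [0..<c])))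
         (sort_key fst (concat (map (\<lambda>j. initiations (q j) (r j) T tp) [0..<c])))"

definition list_before :: "real \<Rightarrow> (real \<times> real \<times> real) list \<Rightarrow> (real \<times> real \<times> real) list" where
  "list_before T xs =
     map (\<lambda>(t, J, S). (T, max J T, max (J + S) T - max J T)) (filter (\<lambda>(t, J, S). t \<le> T) xs)"

definition list_after :: "real \<Rightarrow> (real \<times> real \<times> real) list \<Rightarrow> (real \<times> real \<times> real) list" where
  "list_after T xs = filter (\<lambda>(t, J, S). T < t) xs"

definition upper_process ::
    "nat \<Rightarrow> (nat \<Rightarrow> queue_input) \<Rightarrow> (nat \<Rightarrow> nat \<Rightarrow> real \<Rightarrow> real) \<Rightarrow> real \<Rightarrow> real
       \<Rightarrow> real \<Rightarrow> real list" where
  "upper_process c q r tp T t =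
     kw_workload T (replicate c 0)
       (map (\<lambda>(a, J, S). (a, S)) (list_before T (triples c q r T tp))
        @ map (\<lambda>(a, J, S). (a, S)) (list_after T (triples c q r T tp))) t"

definition lower_process ::
    "nat \<Rightarrow> (nat \<Rightarrow> queue_input) \<Rightarrow> (nat \<Rightarrow> nat \<Rightarrow> real \<Rightarrow> real) \<Rightarrow> real \<Rightarrow> real
       \<Rightarrow> real \<Rightarrow> real list" where
  "lower_process c q r tp T t =
     kw_workload T (replicate c 0)
       (map (\<lambda>(a, J, S). (a, 0)) (list_before T (triples c q r T tp))
        @ map (\<lambda>(a, J, S). (a, S)) (list_after T (triples c q r T tp))) t"

end

theory Submission
  imports Defs
begin

text \<open>
  In absolute time a workload vector lists the times from which the servers are free. The union of the
  single-server queues \<open>Y\<^sub>j\<close> is itself a \<open>c\<close>-server system which assigns the durations \<open>S\<^sub>k\<close> at the times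
  \<open>J\<^sub>k\<close> in order of initiation; serving them greedily initiates the \<open>k\<close>-th service of \<open>U\<close> started at \<open>T'\<close>
  by \<open>max J\<^sub>k T'\<close>. As \<open>x \<mapsto> max (x + s) T - max x T\<close> is increasing, the work that this service leaves
  after \<open>T\<close> is at most \<open>R\<^sub>k\<close>, so that at time \<open>T\<close> the process started at \<open>T'\<close> is below the one fed with all
  the \<open>R\<^sub>k\<close>; after \<open>T\<close> both have the same input.

  The inputs for \<open>T\<close> and \<open>T'\<close> can be compared because each time-reversed queue is empty at \<open>\<tau>\<^sub>j\<close>: the work of
  the customers that enter and leave the processor-sharing queue within an interval is at most the length
  of the interval. The lists for \<open>T'\<close> thus contain those for \<open>T\<close> and in addition only services that end by
  \<open>T\<close>, for which \<open>R\<^sub>k = 0\<close>. Almost surely the queues empty at arbitrarily late times, as the sum of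
  interarrival times minus durations is unbounded by the weak law of large numbers.
\<close>

section \<open>The workload recursion in absolute time\<close>

abbreviation le_list :: "real list \<Rightarrow> real list \<Rightarrow> bool" where
  "le_list \<equiv> list_all2 (\<le>)"

lemma kw_dominated_iff: "v \<unlhd> w \<longleftrightarrow> le_list v w"
  by (auto simp: kw_dominated_def list_all2_conv_all_nth)

lemma insort_mono:
  assumes "le_list xs ys" "a \<le> b" "sorted xs" "sorted ys"
  shows "le_list (insort a xs) (insort b ys)"
  using assms
proof (induction arbitrary: a b rule: list_all2_induct)
  case (Cons x xs y ys)
  \<comment> \<open>Reading \<open>x # xs\<close> and \<open>y # ys\<close> as insertions turns the
    mixed cases, in which only one of the two insertions stops at the head, into instances of the
    induction hypothesis for \<open>x\<close>, \<open>b\<close> and for \<open>a\<close>,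
    \<open>y\<close>.\<close>
  have x: "insort x xs = x # xs" and y: "insort y ys = y # ys"
    using Cons.prems by (auto simp: insort_is_Cons)
  have s: "sorted xs" "sorted ys" using Cons.prems by auto
  show ?case
    using Cons.IH[of a b] Cons.IH[of x b] Cons.IH[of a y] Cons.hyps Cons.prems(1) s x y
    by auto
qed auto

lemma sorted_map_mono: "mono f \<Longrightarrow> sorted xs \<Longrightarrow> sorted (map f xs)"
  for f :: "'a::linorder \<Rightarrow> 'b::linorder"
  by (auto simp: sorted_iff_nth_mono mono_def)

lemma sorted_map_max: "sorted xs \<Longrightarrow> sorted (map (max a) xs)" for a :: real
  by (intro sorted_map_mono) (auto simp: mono_def)

lemma map_insort_mono:
  fixes f :: "real \<Rightarrow> real"
  assumes "mono f" "sorted xs"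
  shows "map f (insort x xs) = insort (f x) (map f xs)"
proof -
  have "sorted (map f (insort x xs))" "sorted (insort (f x) (map f xs))"
    using assms sorted_map_mono[of f] by (auto simp: sorted_insort)
  moreover have "mset (map f (insort x xs)) = mset (insort (f x) (map f xs))"
    by simp
  ultimately show ?thesis
    by (metis properties_for_sort sorted_sort_id)
qed

text \<open>Clipping every free time at \<open>a\<close> corresponds to truncating the drained
  workload at 0: after subtracting \<open>a\<close>, this is the Kiefer-Wolfowitz update at an
  arrival.\<close>

definition free_step :: "real \<Rightarrow> real \<Rightarrow> real list \<Rightarrow> real list" where
  "free_step a s F = insort (max a (hd F) + s) (map (max a) (tl F))"

text \<open>
  The Kiefer--Wolfowitz recursion in absolute time: the entries are the times from which the servers
  are free, so that an arrival at \<open>a\<close> initiates its service at \<open>max a (hd F)\<close>.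
\<close>

definition free_times :: "real list \<Rightarrow> (real \<times> real) list \<Rightarrow> real list" where
  "free_times F as = fold (\<lambda>(a, s). free_step a s) as F"

lemma free_times_simps [simp]:
  "free_times F [] = F"
  "free_times F ((a, s) # as) = free_times (free_step a s F) as"
  "free_times F (as @ bs) = free_times (free_times F as) bs"
  by (simp_all add: free_times_def)

lemma length_free_step [simp]: "F \<noteq> [] \<Longrightarrow> length (free_step a s F) = length F"
  by (simp add: free_step_def)

lemma free_step_nonempty [simp]: "free_step a s F \<noteq> []"
  by (simp add: free_step_def)

lemma sorted_free_step [simp]: "sorted F \<Longrightarrow> sorted (free_step a s F)"
  by (simp add: free_step_def sorted_insort sorted_map_max sorted_tl)

lemma free_times_props:
  assumes "F \<noteq> []" "sorted F"
  shows "length (free_times F as) = length F" "sorted (free_times F as)"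
  using assms by (induction as arbitrary: F) auto

lemma hd_mono: "le_list F G \<Longrightarrow> F \<noteq> [] \<Longrightarrow> hd F \<le> hd G"
  by (cases F; cases G) auto

lemma map_free_step:
  assumes "F \<noteq> []" "sorted F"
  shows "map (\<lambda>x. x - a) (free_step a s F) = kw_arrive s (map (\<lambda>x. max 0 (x - a)) F)"
proof (cases F)
  case (Cons f fs)
  have "mono (\<lambda>x. x - a)" by (auto simp: mono_def)
  then have "map (\<lambda>x. x - a) (free_step a s F) =
      insort (max a f + s - a) (map (\<lambda>x. x - a) (map (max a) fs))"
    unfolding free_step_def using assms Cons
    by (simp only: list.sel, intro map_insort_mono) (auto simp: sorted_map_max)
  moreover have "map (\<lambda>x. x - a) (map (max a) fs) = map (\<lambda>x. max 0 (x - a)) fs"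
    by (auto simp: max_def)
  moreover have "sorted (map (\<lambda>x. max 0 (x - a)) fs)"
    using assms Cons by (intro sorted_map_mono) (auto simp: mono_def)
  moreover have "max a f + s - a = max 0 (f - a) + s" by auto
  ultimately show ?thesis
    using Cons by (simp add: sorted_sort_id del: map_map)
qed (use assms in auto)

text \<open>In absolute time nothing drains between arrivals, so that only the truncation at
  \<open>t\<close> remains. All arrivals must have occurred by \<open>t\<close>, since
  \<open>free_times\<close> always processes the whole list.\<close>

lemma kw_workload_free_times:
  assumes "v \<noteq> []" "sorted v" "\<forall>(a, s)\<in>set as. a \<le> t"
  shows "kw_workload u v as t = map (\<lambda>x. max 0 (x - t)) (free_times (map (\<lambda>x. x + u) v) as)"
  using assms
proof (induction as arbitrary: u v)
  case Nil
  then show ?case by (simp add: kw_drain_def algebra_simps)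
next
  case (Cons p as)
  obtain a s where p: "p = (a, s)" by force
  let ?F = "map (\<lambda>x. x + u) v"
  let ?v = "kw_arrive s (kw_drain (a - u) v)"
  have F: "?F \<noteq> []" "sorted ?F"
    using Cons.prems by (auto intro!: sorted_map_mono simp: mono_def)
  have "?v = map (\<lambda>x. x - a) (free_step a s ?F)"
    using map_free_step[OF F, of a s] by (simp add: kw_drain_def o_def algebra_simps)
  moreover from this have "?v \<noteq> []" "sorted ?v"
    using F by (auto intro!: sorted_map_mono simp: mono_def)
  ultimately show ?case
    using Cons by (simp add: p o_def)
qed

lemma sorted_drain: "sorted v \<Longrightarrow> sorted (kw_drain d v)"
  unfolding kw_drain_def by (intro sorted_map_mono) (auto simp: mono_def)

lemma sorted_kw_arrive: "sorted (kw_arrive s v)"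
  by (cases v) (simp_all del: sort_key_simps)

lemma kw_drain_mono: "le_list v w \<Longrightarrow> le_list (kw_drain d v) (kw_drain d w)"
  by (auto simp: kw_drain_def list_all2_conv_all_nth max_def)

lemma kw_arrive_mono:
  assumes "le_list v w" "s \<le> t" "sorted v" "sorted w"
  shows "le_list (kw_arrive s v) (kw_arrive t w)"
  using assms
  by (cases v; cases w) (auto simp: sorted_sort_id intro!: insort_mono)

lemma kw_workload_mono:
  assumes "list_all2 (\<lambda>(a, s) (b, t). a = b \<and> s \<le> t) as bs" "le_list v w" "sorted v" "sorted w"
  shows "le_list (kw_workload u v as t) (kw_workload u w bs t)"
  using assms
proof (induction arbitrary: u v w rule: list_all2_induct)
  case Nil
  then show ?case by (simp add: kw_drain_mono)
next
  case (Cons p as p' bs)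
  obtain a s s' where p: "p = (a, s)" "p' = (a, s')" "s \<le> s'"
    using Cons.hyps by (cases p; cases p') auto
  show ?case
    unfolding p using Cons.prems p(3)
    by (auto intro!: Cons.IH kw_arrive_mono kw_drain_mono sorted_drain sorted_kw_arrive)
qed

lemma kw_drain_drain: "d \<ge> 0 \<Longrightarrow> kw_drain d (kw_drain e v) = kw_drain (e + d) v"
  by (auto simp: kw_drain_def)

text \<open>The restart at \<open>T\<close> reduces a comparison of two processes with equal input
  after \<open>T\<close> to one of their states at \<open>T\<close>. Arrivals at \<open>T\<close>
  itself count as past, as the paths are right-continuous.\<close>

lemma kw_workload_append:
  assumes "\<forall>(a, s)\<in>set as. a \<le> T" "\<forall>(a, s)\<in>set bs. T < a" "T \<le> t"
  shows "kw_workload u v (as @ bs) t = kw_workload T (kw_workload u v as T) bs t"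
  using assms(1)
proof (induction as arbitrary: u v)
  case Nil
  show ?case
    using assms(2,3) by (cases bs) (auto simp: kw_drain_drain)
next
  case (Cons p as)
  then show ?case using assms(3) by (cases p) auto
qed

section \<open>Work left after a given time, and feasible schedules\<close>

definition residual_after :: "real \<Rightarrow> real \<Rightarrow> real \<Rightarrow> real" where
  "residual_after T J S = max (J + S) T - max J T"

lemma residual_after_nonneg: "0 \<le> S \<Longrightarrow> 0 \<le> residual_after T J S"
  by (auto simp: residual_after_def)

text \<open>For nonnegative \<open>S\<close> the value \<open>residual_after T J S\<close> is the
  length of the part after \<open>T\<close> of the service interval from \<open>J\<close> to
  \<open>J + S\<close>. Moving the interval to the right cannot shorten this part.\<close>

lemma residual_after_mono: "0 \<le> S \<Longrightarrow> I \<le> J \<Longrightarrow> residual_after T I S \<le> residual_after T J S"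
  by (auto simp: residual_after_def max_def)

text \<open>Cutting a service interval at \<open>T'\<close> and then at the later time
  \<open>T\<close> leaves the same piece as cutting it at \<open>T\<close> directly.\<close>

lemma residual_after_residual_after:
  "T' \<le> T \<Longrightarrow> residual_after T (max J T') (residual_after T' J S) = residual_after T J S"
  by (auto simp: residual_after_def max_def)

text \<open>
  The pairs (time of initiation, service duration) in a list can be realised, in this order, by
  servers that are free from the times in \<open>g\<close> on.
\<close>

fun feasible :: "real list \<Rightarrow> (real \<times> real) list \<Rightarrow> bool" where
  "feasible g [] = True"
| "feasible g ((J, S) # zs) = (hd g \<le> J \<and> feasible (free_step J S g) zs)"

lemma feasible_append: "feasible g (xs @ ys) \<Longrightarrow> feasible g xs"
  by (induction g xs rule: feasible.induct) auto

lemma list_all2_tlI: "list_all2 P xs ys \<Longrightarrow> list_all2 P (tl xs) (tl ys)"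
  by (cases xs; cases ys) auto

text \<open>Two invariants are carried along. The greedy free times \<open>F\<close> stay below the
  free times \<open>g\<close> of the schedule clipped at \<open>T'\<close>, which lets each service
  start by \<open>max J T'\<close>. Hence the work it leaves after \<open>T\<close> is at most the
  residual fed to \<open>W\<close>, and \<open>F\<close> clipped at \<open>T\<close> stays below
  \<open>W\<close>.\<close>

lemma free_times_le_residuals:
  assumes "\<forall>(t, J, S)\<in>set zs. t \<le> T \<and> t \<le> J \<and> 0 \<le> S" "T' \<le> T"
    and "feasible g (map snd zs)"
    and "F \<noteq> []" "sorted F" "sorted g" "sorted W"
    and "le_list F (map (max T') g)" "le_list (map (max T) F) W"
  shows "le_list
    (map (max T) (free_times F (map (\<lambda>(t, J, S). (max t T', residual_after T' J S)) zs)))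
    (free_times W (map (\<lambda>(t, J, S). (T, residual_after T J S)) zs))"
  using assms
proof (induction zs arbitrary: F g W)
  case (Cons z zs)
  obtain t J S where z: "z = (t, J, S)" using prod_cases3 by blast
  let ?a = "max t T'" and ?s = "residual_after T' J S"
  have tJ: "t \<le> T" "t \<le> J" "0 \<le> S" "hd g \<le> J" using Cons.prems z by auto
  have s: "0 \<le> ?s" using tJ by (simp add: residual_after_nonneg)
  have ne: "g \<noteq> []" "W \<noteq> []" using Cons.prems by (auto simp: list_all2_conv_all_nth)
  have hdF: "hd F \<le> max T' (hd g)" "max T (hd F) \<le> hd W"
    using hd_mono[OF Cons.prems(8)] hd_mono[OF Cons.prems(9)] Cons.prems(4) ne
    by (auto simp: hd_map)
  \<comment> \<open>\<open>I\<close> is the time at which the greedy queue initiates this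
    service.\<close>
  define I where "I = max ?a (hd F)"
  have I: "I \<le> max J T'" "max I T = max T (hd F)"
    using hdF(1) tJ Cons.prems(2) by (auto simp: I_def)
  \<comment> \<open>The service of length \<open>?s\<close> from \<open>I\<close> leaves at most as
    much after \<open>T\<close> as the same service from \<open>max J T'\<close>, and the latter
    leaves exactly \<open>residual_after T J S\<close>.\<close>
  have R: "max (I + ?s) T \<le> max T (hd F) + residual_after T J S"
    using residual_after_mono[OF s I(1), of T] residual_after_residual_after[OF Cons.prems(2), of J S] I(2)
    unfolding residual_after_def[of T I ?s] by linarith
  have mono_max: "mono (max x)" for x :: real
    by (auto simp: mono_def)
  have tails: "list_all2 (\<lambda>x y. x \<le> max T' y) (tl F) (tl g)"
    "list_all2 (\<lambda>x y. max T x \<le> y) (tl F) (tl W)"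
    using list_all2_tlI[OF Cons.prems(8)] list_all2_tlI[OF Cons.prems(9)]
    by (simp_all add: list_all2_map1 list_all2_map2 flip: map_tl)
  have 1: "le_list (free_step ?a ?s F) (map (max T') (free_step J S g))"
  proof -
    have "map (max T') (free_step J S g) =
        insort (max T' (max J (hd g) + S)) (map (max T') (map (max J) (tl g)))"
      unfolding free_step_def
      by (intro map_insort_mono mono_max sorted_map_max sorted_tl Cons.prems)
    moreover have "max ?a (hd F) + ?s \<le> max T' (max J (hd g) + S)"
      using I(1) tJ(4) unfolding I_def[symmetric] by (simp add: residual_after_def max_absorb1 max.commute)
    moreover have "le_list (map (max ?a) (tl F)) (map (max T') (map (max J) (tl g)))"
      using tails(1) tJ(2) by (auto simp: list_all2_map1 list_all2_map2 elim!: list_all2_mono)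
    ultimately show ?thesis
      unfolding free_step_def[of ?a]
      by (auto intro!: insort_mono sorted_map_max sorted_tl Cons.prems simp del: map_map)
  qed
  have 2: "le_list (map (max T) (free_step ?a ?s F)) (free_step T (residual_after T J S) W)"
  proof -
    have A: "map (max T) (free_step ?a ?s F) =
        insort (max T (I + ?s)) (map (max T) (map (max ?a) (tl F)))"
      unfolding free_step_def I_def
      by (intro map_insort_mono mono_max sorted_map_max sorted_tl Cons.prems)
    have B: "le_list (map (max T) (map (max ?a) (tl F))) (map (max T) (tl W))"
      using tails(2) tJ(1) Cons.prems(2)
      by (auto simp: list_all2_map1 list_all2_map2 elim!: list_all2_mono)
    have C: "max T (I + ?s) \<le> max T (hd W) + residual_after T J S"
      using R hdF(2) by linarith
    show ?thesis
      unfolding A free_step_def[of T]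
      by (intro insort_mono B C sorted_map_max sorted_tl Cons.prems)
  qed
  show ?case
    unfolding z list.map prod.case free_times_simps
  proof (rule Cons.IH[OF _ Cons.prems(2) _ _ _ _ _ 1 2])
    show "\<forall>(t, J, S)\<in>set zs. t \<le> T \<and> t \<le> J \<and> 0 \<le> S" "feasible (free_step J S g) (map snd zs)"
      using Cons.prems(1,3) z by auto
  qed (simp_all add: Cons.prems)
qed auto

lemma free_step_0:
  assumes "sorted W" "W \<noteq> []" "\<forall>x\<in>set W. T \<le> x"
  shows "free_step T 0 W = W"
proof -
  have "map (max T) (tl W) = tl W" "max T (hd W) = hd W"
    using assms by (auto intro!: map_idI simp: max_absorb2 list.set_sel)
  then show ?thesis
    using assms by (cases W) (auto simp: free_step_def insort_is_Cons)
qed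

lemma free_step_ge: "0 \<le> s \<Longrightarrow> \<forall>x\<in>set (free_step T s W). T \<le> x"
  by (auto simp: free_step_def set_insort_key)

text \<open>A service that is over by \<open>T\<close> has residual 0, and an arrival without work
  at \<open>T\<close> does not change free times that are all at least \<open>T\<close>. Input lists
  that differ only by such services can therefore be exchanged.\<close>

lemma free_times_filter:
  assumes "sorted W" "W \<noteq> []" "\<forall>x\<in>set W. T \<le> x" "\<forall>(J, S)\<in>set xs. 0 \<le> S"
  shows "free_times W (map (\<lambda>(J, S). (T, residual_after T J S)) xs) =
    free_times W (map (\<lambda>(J, S). (T, residual_after T J S)) (filter (\<lambda>(J, S). T < J + S) xs))"
  using assms
proof (induction xs arbitrary: W)
  case (Cons p xs)
  obtain J S where p: "p = (J, S)" by force
  show ?case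
  proof (cases "T < J + S")
    case True
    moreover have "\<forall>x\<in>set (free_step T (residual_after T J S) W). T \<le> x"
      using Cons.prems p by (intro free_step_ge residual_after_nonneg) auto
    ultimately show ?thesis
      using Cons.IH[of "free_step T (residual_after T J S) W"] Cons.prems p by simp
  next
    case False
    then have "residual_after T J S = 0" using Cons.prems p by (auto simp: residual_after_def)
    then show ?thesis using Cons False p by (simp add: free_step_0)
  qed
qed auto

section \<open>Merging single-server schedules\<close>

fun chain :: "real \<Rightarrow> (real \<times> real) list \<Rightarrow> bool" where
  "chain f [] = True"
| "chain f ((J, S) # xs) = (f \<le> J \<and> chain (J + S) xs)"

lemma chain_antimono: "chain f xs \<Longrightarrow> f' \<le> f \<Longrightarrow> chain f' xs"
  by (cases "(f, xs)" rule: chain.cases) auto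

text \<open>A chain may contain idle times between its services, so removing services only lengthens
  the gaps. This is why chains are used for the filtered list \<open>initiations\<close>, which need
  not satisfy the exact recursion of \<open>fcfs_starts\<close>.\<close>

lemma chain_filter:
  "chain f xs \<Longrightarrow> \<forall>(J, S)\<in>set xs. 0 \<le> S \<Longrightarrow> chain f (filter P xs)"
proof (induction f xs rule: chain.induct)
  case (2 f J S xs)
  then show ?case using chain_antimono[of "J + S" "filter P xs" f] by auto
qed auto

lemma chain_ge: "chain f xs \<Longrightarrow> \<forall>(J, S)\<in>set xs. 0 \<le> S \<Longrightarrow> (J, S) \<in> set xs \<Longrightarrow> f \<le> J"
proof (induction f xs rule: chain.induct)
  case (2 f K R xs)
  then show ?case by fastforce
qed auto

lemma chain_sorted: "chain f xs \<Longrightarrow> \<forall>(J, S)\<in>set xs. 0 \<le> S \<Longrightarrow> sorted (map fst xs)"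
proof (induction f xs rule: chain.induct)
  case (2 f J S xs)
  then have "\<forall>y\<in>set xs. J \<le> fst y"
    using chain_ge[of "J + S" xs] by force
  then show ?case using 2 by auto
qed auto

text \<open>The schedule occupies server \<open>j\<close>, whereas \<open>free_step\<close> occupies
  a server that is free first. Both are free by \<open>J\<close>, so after clipping at
  \<open>J\<close> they are interchangeable and the multisets of free times agree. Clipping at a
  lower bound \<open>x\<close> of the remaining initiation times is the invariant; \<open>x\<close>
  advances to \<open>J\<close>.\<close>

lemma labelled_feasible:
  assumes "sorted (map (\<lambda>(j, J, S). J) zs)"
    and "\<forall>(j, J, S)\<in>set zs. j < c \<and> x \<le> J \<and> 0 \<le> S"
    and "\<And>j. j < c \<Longrightarrow> chain (H j) (map snd (filter (\<lambda>(i, z). i = j) zs))"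
  shows "feasible (sort (map (\<lambda>j. max x (H j)) [0..<c])) (map snd zs)"
  using assms
proof (induction zs arbitrary: H x)
  case (Cons z zs)
  obtain j J S where z: "z = (j, J, S)" using prod_cases3 by blast
  define g where "g = sort (map (\<lambda>j. max x (H j)) [0..<c])"
  define H' where "H' = H(j := J + S)"
  have j: "j < c" "x \<le> J" "0 \<le> S" using Cons.prems z by auto
  have HJ: "H j \<le> J" using Cons.prems(3)[OF j(1)] z by simp
  have g: "sorted g" "g \<noteq> []" "set g = (\<lambda>j. max x (H j)) ` {0..<c}"
    using j unfolding g_def by (simp_all flip: length_0_conv)
  have hd: "hd g \<le> J"
  proof -
    have "max x (H j) \<in> set g" using g j by auto
    then have "hd g \<le> max x (H j)" using g(1,2) by (cases g) auto
    then show ?thesis using HJ j by auto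
  qed
  have step: "free_step J S g = sort (map (\<lambda>j. max J (H' j)) [0..<c])"
  proof -
    have "mset g = image_mset (\<lambda>j. max x (H j)) (mset [0..<c])"
      by (simp add: g_def)
    then have "image_mset (max J) (mset g) = image_mset (\<lambda>i. max J (H i)) (mset [0..<c])"
      using j by (simp add: multiset.map_comp o_def max.left_commute[of J] max_absorb1 flip: max.assoc)
    moreover have "image_mset (max J) (mset g) = add_mset J (image_mset (max J) (mset (tl g)))"
      using g(2) hd by (cases g) (auto simp: max_absorb1)
    moreover have c: "mset [0..<c] = add_mset j (mset [0..<c] - {#j#})"
      using j by simp
    have ne: "i \<noteq> j" if "i \<in># mset [0..<c] - {#j#}" for i
      using that by (metis distinct_upt mset_remove1 set_mset_mset set_remove1_eq Diff_iff singletonI)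
    have eq: "image_mset f (mset [0..<c]) =
        add_mset (f j) (image_mset f (mset [0..<c] - {#j#}))" for f :: "nat \<Rightarrow> real"
      by (metis c image_mset_add_mset)
    have "image_mset (\<lambda>i. max J (H i)) (mset [0..<c]) =
        add_mset J (image_mset (\<lambda>i. max J (H i)) (mset [0..<c] - {#j#}))"
      unfolding eq using HJ by (simp add: max_absorb1)
    moreover have "image_mset (\<lambda>i. max J (H' i)) (mset [0..<c]) =
        add_mset (J + S) (image_mset (\<lambda>i. max J (H' i)) (mset [0..<c] - {#j#}))"
      unfolding eq using j by (simp add: H'_def)
    moreover have "image_mset (\<lambda>i. max J (H' i)) (mset [0..<c] - {#j#}) =
        image_mset (\<lambda>i. max J (H i)) (mset [0..<c] - {#j#})"
      using ne by (intro image_mset_cong) (auto simp: H'_def)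
    ultimately have "mset (free_step J S g) = mset (map (\<lambda>j. max J (H' j)) [0..<c])"
      using hd by (simp add: free_step_def max_absorb1)
    then show ?thesis
      using sorted_free_step[OF g(1), of J S] by (metis properties_for_sort)
  qed
  have "feasible (free_step J S g) (map snd zs)"
    unfolding step
  proof (rule Cons.IH)
    show "\<forall>(j, K, S)\<in>set zs. j < c \<and> J \<le> K \<and> 0 \<le> S"
      using Cons.prems(1,2) z by fastforce
    show "chain (H' i) (map snd (filter (\<lambda>(k, z). k = i) zs))" if "i < c" for i
      using Cons.prems(3)[OF that] z by (auto simp: H'_def split: if_splits)
  qed (use Cons.prems z in auto)
  then show ?case using hd by (simp add: z g_def)
qed auto

lemma map_sort_key: "map f (sort_key (\<lambda>x. g (f x)) xs) = sort_key g (map f xs)"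
proof -
  have "map f (insort_key (\<lambda>x. g (f x)) a ys) = insort_key g (f a) (map f ys)" for a ys
    by (induction ys) auto
  then show ?thesis by (induction xs) auto
qed

text \<open>Each pair is labelled with its queue before sorting, so that every queue acts as one
  server of the merged system. Sorting is stable and each chain is already sorted, hence the pairs
  of each queue reappear in their original order, also in the case of ties.\<close>

lemma sort_concat_feasible:
  assumes "\<And>j. j < c \<Longrightarrow> chain (H j) (xs j)" "\<And>j. j < c \<Longrightarrow> \<forall>(J, S)\<in>set (xs j). 0 \<le> S"
  obtains g where "length g = c" "sorted g" "feasible g (sort_key fst (concat (map xs [0..<c])))"
proof -
  define zs where "zs = concat (map (\<lambda>j. map (Pair j) (xs j)) [0..<c])"
  define ss where "ss = sort_key (\<lambda>z. fst (snd z)) zs"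
  have fe: "map snd ss = sort_key fst (concat (map xs [0..<c]))"
    by (simp add: ss_def zs_def map_sort_key map_concat o_def)
  have set: "set ss = {(j, z). j < c \<and> z \<in> set (xs j)}"
    by (auto simp: ss_def zs_def)
  have fil: "filter (\<lambda>(i, z). i = j) zs = map (Pair j) (xs j)" if "j < c" for j
  proof -
    have "filter (\<lambda>(i, z). i = j) (concat (map (\<lambda>j. map (Pair j) (xs j)) [0..<n])) =
      (if j < n then map (Pair j) (xs j) else [])" for n
      by (induction n) (auto simp: filter_map o_def less_Suc_eq)
    then show ?thesis using that by (simp add: zs_def)
  qed
  have "map snd (filter (\<lambda>(i, z). i = j) ss) = xs j" if "j < c" for j
  proof -
    have "filter (\<lambda>(i, z). i = j) ss = sort_key (\<lambda>z. fst (snd z)) (map (Pair j) (xs j))"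
      unfolding ss_def filter_sort fil[OF that] ..
    also have "\<dots> = map (Pair j) (xs j)"
      using chain_sorted[OF assms(1,2)[OF that]] by (intro sorted_sort_id sort_key_id_if_sorted) (simp add: o_def)
    finally show ?thesis by (simp add: o_def)
  qed
  \<comment> \<open>Any lower bound of the initiation times serves as the first clipping
    level.\<close>
  moreover obtain x where "\<forall>z\<in>set ss. x \<le> fst (snd z)"
  proof -
    have "bdd_below ((\<lambda>z. fst (snd z)) ` set ss)" by (intro bdd_below_finite) auto
    then show ?thesis using that by (auto simp: bdd_below_def)
  qed
  moreover have "sorted (map (\<lambda>(j, J, S). J) ss)"
    using sorted_sort_key[of "\<lambda>z. fst (snd z)" zs] by (simp add: ss_def case_prod_unfold)
  ultimately have "feasible (sort (map (\<lambda>j. max x (H j)) [0..<c])) (map snd ss)"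
    using assms(1) by (intro labelled_feasible) (auto simp: set dest: assms(2))
  then show ?thesis
    using fe by (intro that) auto
qed

section \<open>Upper and lower queues\<close>

lemma free_times_0:
  assumes "sorted W" "W \<noteq> []" "\<forall>x\<in>set W. T \<le> x"
  shows "free_times W (map (\<lambda>_. (T, 0)) xs) = W"
  using assms by (induction xs) (auto simp: free_step_0)

lemma kw_workload_arrived:
  assumes "0 < c" "\<forall>(a, s)\<in>set as. a \<le> t"
  shows "kw_workload u (replicate c 0) as t = map (\<lambda>x. max 0 (x - t)) (free_times (replicate c u) as)"
    "sorted (kw_workload u (replicate c 0) as t)"
    "le_list (replicate c 0) (kw_workload u (replicate c 0) as t)"
proof -
  show *: "kw_workload u (replicate c 0) as t = map (\<lambda>x. max 0 (x - t)) (free_times (replicate c u) as)"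
    using assms by (subst kw_workload_free_times) auto
  have F: "length (free_times (replicate c u) as) = c" "sorted (free_times (replicate c u) as)"
    using assms(1) by (simp_all add: free_times_props)
  show "sorted (kw_workload u (replicate c 0) as t)"
    unfolding * using F by (intro sorted_map_mono) (auto simp: mono_def)
  show "le_list (replicate c 0) (kw_workload u (replicate c 0) as t)"
    unfolding * using F by (auto simp: list_all2_conv_all_nth)
qed

lemma filter_append_filter_not:
  assumes "sorted (map f xs)" "\<And>x y. f x \<le> f y \<Longrightarrow> P y \<Longrightarrow> P x"
  shows "filter P xs @ filter (\<lambda>x. \<not> P x) xs = xs"
  using assms(1)
proof (induction xs)
  case (Cons x xs)
  show ?case
  proof (cases "P x")
    case False
    then have "\<forall>y\<in>set (x # xs). \<not> P y"
      using Cons.prems assms(2) by auto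
    then have "filter (\<lambda>y. \<not> P y) (x # xs) = x # xs" "filter P (x # xs) = []"
      by (auto simp: filter_id_conv filter_empty_conv)
    then show ?thesis by simp
  qed (use Cons in auto)
qed auto

lemma sorted_split:
  "sorted (map f xs) \<Longrightarrow> filter (\<lambda>x. f x \<le> a) xs @ filter (\<lambda>x. a < f x) xs = xs"
  for a :: "'b::linorder"
  using filter_append_filter_not[of f xs "\<lambda>x. f x \<le> a"] by (simp add: not_le order_trans)

text \<open>The arrivals up to \<open>T\<close> form a prefix of the sorted list. Splitting the
  triples by arrival time thus cuts the initiations by position, at index \<open>n\<close>, and not
  at time \<open>T\<close>.\<close>

lemma filter_zip_sorted:
  fixes T :: real
  assumes "sorted A"
  defines "n \<equiv> length (filter (\<lambda>t. t \<le> T) A)"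
  shows "filter (\<lambda>(t, z). t \<le> T) (zip A B) = zip (filter (\<lambda>t. t \<le> T) A) (take n B)"
    and "filter (\<lambda>(t, z). T < t) (zip A B) = zip (filter (\<lambda>t. T < t) A) (drop n B)"
proof -
  define A1 A2 where "A1 = filter (\<lambda>t. t \<le> T) A" and "A2 = filter (\<lambda>t. T < t) A"
  have "A = A1 @ A2"
    using sorted_split[of id A T] assms(1) by (simp add: A1_def A2_def)
  moreover have "zip (A1 @ A2) B = zip A1 (take n B) @ zip A2 (drop n B)"
    by (simp add: zip_append1 n_def A1_def)
  ultimately have z: "zip A B = zip A1 (take n B) @ zip A2 (drop n B)" by simp
  have 1: "\<forall>p\<in>set (zip A1 (take n B)). fst p \<le> T" "\<forall>p\<in>set (zip A2 (drop n B)). T < fst p"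
    by (auto dest!: set_zip_leftD simp: A1_def A2_def)
  show "filter (\<lambda>(t, z). t \<le> T) (zip A B) = zip (filter (\<lambda>t. t \<le> T) A) (take n B)"
    "filter (\<lambda>(t, z). T < t) (zip A B) = zip (filter (\<lambda>t. T < t) A) (drop n B)"
    unfolding z A1_def[symmetric] A2_def[symmetric] using 1
    by (auto simp: filter_id_conv filter_empty_conv case_prod_unfold not_le not_less)
qed

text \<open>With the list of triples as a parameter, the comparison becomes a statement about lists,
  separate from the way in which the triples arise.\<close>

definition upper_queue :: "nat \<Rightarrow> real \<Rightarrow> (real \<times> real \<times> real) list \<Rightarrow> real \<Rightarrow> real list" where
  "upper_queue c T zs t = kw_workload T (replicate c 0)
     (map (\<lambda>(a, J, S). (a, S)) (list_before T zs) @ map (\<lambda>(a, J, S). (a, S)) (list_after T zs)) t"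

definition lower_queue :: "nat \<Rightarrow> real \<Rightarrow> (real \<times> real \<times> real) list \<Rightarrow> real \<Rightarrow> real list" where
  "lower_queue c T zs t = kw_workload T (replicate c 0)
     (map (\<lambda>(a, J, S). (a, 0)) (list_before T zs) @ map (\<lambda>(a, J, S). (a, S)) (list_after T zs)) t"

lemma lower_queue_le_upper_queue:
  assumes "\<forall>(t, J, S)\<in>set zs. 0 \<le> S"
  shows "lower_queue c T zs t \<unlhd> upper_queue c T zs t"
  unfolding kw_dominated_iff lower_queue_def upper_queue_def
proof (rule kw_workload_mono)
  have "list_all2 (\<lambda>(a, s) (b, t). a = b \<and> s \<le> t)
      (map (\<lambda>(a, J, S). (a, 0)) (list_before T zs)) (map (\<lambda>(a, J, S). (a, S)) (list_before T zs))"
    using assms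
    by (induction zs) (auto simp: list_before_def)
  then show "list_all2 (\<lambda>(a, s) (b, t). a = b \<and> s \<le> t)
      (map (\<lambda>(a, J, S). (a, 0)) (list_before T zs) @ map (\<lambda>(a, J, S). (a, S)) (list_after T zs))
      (map (\<lambda>(a, J, S). (a, S)) (list_before T zs) @ map (\<lambda>(a, J, S). (a, S)) (list_after T zs))"
    by (rule list_all2_appendI) (auto simp: list_all2_same)
qed (auto simp: list_all2_same)

text \<open>At time \<open>T\<close> the lower queue started at \<open>T\<close> has received only
  zero durations and is still empty, so it lies below any other state. The inputs after
  \<open>T\<close> coincide.\<close>

lemma lower_queue_le_lower_queue:
  assumes "0 < c" "T' \<le> T" "T \<le> t" "sorted (map fst zs')"
    and after: "list_after T zs = list_after T zs'"
  shows "lower_queue c T zs t \<unlhd> lower_queue c T' zs' t"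
proof -
  define bs where "bs = map (\<lambda>(a, J, S). (a, S)) (list_after T zs)"
  define as where "as = map (\<lambda>(a, J, S). (a, 0 :: real)) (list_before T zs)"
  define as' where "as' = map (\<lambda>(a, J, S). (a, 0 :: real)) (list_before T' zs')
    @ map (\<lambda>(a, J, S). (a, S)) (filter (\<lambda>(t, J, S). t \<le> T) (list_after T' zs'))"
  have bs: "\<forall>(a, s)\<in>set bs. T < a" by (auto simp: bs_def list_after_def)
  have as: "as = map (\<lambda>_. (T, 0)) (filter (\<lambda>(t, J, S). t \<le> T) zs)"
    by (auto simp: as_def list_before_def)
  have as': "\<forall>(a, s)\<in>set as'. a \<le> T"
    using assms(2) by (auto simp: as'_def list_before_def)
  have "sorted (map fst (list_after T' zs'))"
    using assms(4) unfolding list_after_def by (rule sorted_filter)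
  moreover have "T' < x \<and> T < x \<longleftrightarrow> T < x" for x using assms(2) by auto
  ultimately have "list_after T' zs' =
      filter (\<lambda>(t, J, S). t \<le> T) (list_after T' zs') @ list_after T zs'"
    using sorted_split[of fst "list_after T' zs'" T] by (simp add: list_after_def case_prod_unfold)
  then have "map (\<lambda>(a, J, S). (a, 0)) (list_before T' zs') @ map (\<lambda>(a, J, S). (a, S)) (list_after T' zs')
      = as' @ bs"
    unfolding as'_def bs_def after by (metis append_assoc map_append)
  then have 2: "lower_queue c T' zs' t = kw_workload T (kw_workload T' (replicate c 0) as' T) bs t"
    using kw_workload_append[OF as' bs assms(3)] by (simp add: lower_queue_def)
  have 1: "lower_queue c T zs t = kw_workload T (kw_workload T (replicate c 0) as T) bs t"
    unfolding lower_queue_def as_def[symmetric] bs_def[symmetric]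
    by (rule kw_workload_append) (use as bs assms(3) in auto)
  have "free_times (replicate c T) as = replicate c T"
    unfolding as using assms(1) by (intro free_times_0) auto
  then have "kw_workload T (replicate c 0) as T = replicate c 0"
    using assms(1) by (subst kw_workload_arrived) (auto simp: as)
  then show ?thesis
    unfolding kw_dominated_iff 1 2
    using kw_workload_arrived[OF assms(1) as'] kw_workload_arrived[OF assms(1), of as T T]
    by (intro kw_workload_mono) (auto simp: list_all2_same as)
qed

text \<open>One formula covers both lists: if \<open>T < t\<close>, then also \<open>T < J\<close>,
  and clipping at \<open>T\<close> alters neither the arrival time nor the duration.\<close>

lemma upper_queue_eq:
  assumes "sorted (map fst zs)" "\<forall>(t, J, S)\<in>set zs. t \<le> J \<and> 0 \<le> S"
  shows "upper_queue c T zs t = kw_workload T (replicate c 0)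
    (map (\<lambda>(t, J, S). (max t T, residual_after T J S)) zs) t"
proof -
  have "map (\<lambda>(t, J, S). (max t T, residual_after T J S)) (filter (\<lambda>(t, J, S). t \<le> T) zs)
      = map (\<lambda>(a, J, S). (a, S)) (list_before T zs)"
    by (auto simp: list_before_def residual_after_def)
  moreover have "map (\<lambda>(t, J, S). (max t T, residual_after T J S)) (list_after T zs)
      = map (\<lambda>(a, J, S). (a, S)) (list_after T zs)"
    using assms(2) by (force simp: list_after_def residual_after_def)
  moreover have "filter (\<lambda>(t, J, S). t \<le> T) zs @ list_after T zs = zs"
    using sorted_split[OF assms(1), of T] by (simp add: list_after_def case_prod_unfold)
  ultimately show ?thesis
    unfolding upper_queue_def by (metis map_append)
qed

text \<open>It suffices to compare the states at \<open>T\<close>. There the queue from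
  \<open>T'\<close> lies below the one fed at \<open>T\<close> with the residuals of the triples
  \<open>zs'\<close>. By \<open>before\<close>, these residuals differ from those of
  \<open>zs\<close> only by zeros.\<close>

lemma upper_queue_le_upper_queue:
  assumes "0 < c" "T' \<le> T" "T \<le> t" "sorted (map fst zs')" "\<forall>(t, J, S)\<in>set zs'. t \<le> J \<and> 0 \<le> S"
    and S: "\<forall>(t, J, S)\<in>set zs. 0 \<le> S"
    and after: "list_after T zs = list_after T zs'"
    and before: "filter (\<lambda>(J, S). T < J + S) (map snd (filter (\<lambda>(t, J, S). t \<le> T) zs)) =
      filter (\<lambda>(J, S). T < J + S) (map snd (filter (\<lambda>(t, J, S). t \<le> T) zs'))"
    and feas: "feasible g (map snd zs')" "length g = c" "sorted g"
  shows "upper_queue c T' zs' t \<unlhd> upper_queue c T zs t"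
proof -
  define ys' where "ys' = filter (\<lambda>(t, J, S). t \<le> T) zs'"
  define ys where "ys = filter (\<lambda>(t, J, S). t \<le> T) zs"
  define as' where "as' = map (\<lambda>(t, J, S). (max t T', residual_after T' J S)) ys'"
  define as where "as = map (\<lambda>(a, J, S). (a, S)) (list_before T zs)"
  define bs where "bs = map (\<lambda>(a, J, S). (a, S)) (list_after T zs)"
  have bs: "\<forall>(a, s)\<in>set bs. T < a" by (auto simp: bs_def list_after_def)
  have as': "\<forall>(a, s)\<in>set as'. a \<le> T"
    using assms(2) by (auto simp: as'_def ys'_def)
  have as: "as = map (\<lambda>(J, S). (T, residual_after T J S)) (map snd ys)"
    by (auto simp: as_def list_before_def ys_def residual_after_def)
  have asT: "\<forall>(a, s)\<in>set as. a \<le> T" by (auto simp: as)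
  have zs': "zs' = ys' @ list_after T zs'"
    using sorted_split[OF assms(4), of T] by (simp add: list_after_def ys'_def case_prod_unfold)
  have "map (\<lambda>(t, J, S). (max t T', residual_after T' J S)) (list_after T zs') = bs"
    unfolding bs_def after using assms(2,5)
    by (force simp: list_after_def residual_after_def)
  then have "map (\<lambda>(t, J, S). (max t T', residual_after T' J S)) zs' = as' @ bs"
    by (subst zs') (simp add: as'_def)
  then have 1: "upper_queue c T' zs' t = kw_workload T (kw_workload T' (replicate c 0) as' T) bs t"
    using kw_workload_append[OF as' bs assms(3)] upper_queue_eq[OF assms(4,5)] by simp
  have 2: "upper_queue c T zs t = kw_workload T (kw_workload T (replicate c 0) as T) bs t"
    unfolding upper_queue_def as_def[symmetric] bs_def[symmetric]
    by (rule kw_workload_append) (use as bs assms(3) in auto)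
  define W where "W = replicate c T"
  have W: "sorted W" "W \<noteq> []" "\<forall>x\<in>set W. T \<le> x" using assms(1) by (auto simp: W_def)
  have "le_list (map (max T) (free_times (replicate c T') as'))
      (free_times W (map (\<lambda>(t, J, S). (T, residual_after T J S)) ys'))"
    unfolding as'_def
  proof (rule free_times_le_residuals)
    show "feasible g (map snd ys')"
      using feas(1) feasible_append zs' by (metis map_append)
    show "le_list (replicate c T') (map (max T') g)"
      using feas(2) by (auto simp: list_all2_conv_all_nth)
    show "le_list (map (max T) (replicate c T')) W"
      using assms(2) by (auto simp: W_def list_all2_conv_all_nth)
  qed (use assms W in \<open>auto simp: ys'_def\<close>)
  also have "map (\<lambda>(t, J, S). (T, residual_after T J S)) ys' =
      map (\<lambda>(J, S). (T, residual_after T J S)) (map snd ys')"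
    by auto
  also have "free_times W \<dots> = free_times W as"
    unfolding as
    using free_times_filter[OF W, of "map snd ys'"] free_times_filter[OF W, of "map snd ys"]
      before S assms(5)
    by (force simp: ys_def ys'_def)
  finally have "le_list (map (\<lambda>x. max 0 (x - T)) (free_times (replicate c T') as'))
      (map (\<lambda>x. max 0 (x - T)) (free_times W as))"
    by (auto simp: list_all2_conv_all_nth)
  then have "le_list (kw_workload T' (replicate c 0) as' T) (kw_workload T (replicate c 0) as T)"
    unfolding kw_workload_arrived(1)[OF assms(1) as'] kw_workload_arrived(1)[OF assms(1) asT] W_def .
  then show ?thesis
    unfolding kw_dominated_iff 1 2
    using kw_workload_arrived[OF assms(1) as'] kw_workload_arrived[OF assms(1) asT]
    by (intro kw_workload_mono) (auto simp: list_all2_same)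
qed

text \<open>The triples are matched by position, so positions must be counted. Passing from
  \<open>T\<close> to \<open>T'\<close> adds as many arrivals as initiations, all of them at or
  before \<open>T\<close>; the initiations after \<open>T\<close> are therefore matched with the
  same arrivals in both cases.\<close>

lemma sandwich:
  assumes "0 < c" "T' \<le> T" "T \<le> t"
    and sorted: "sorted A" "sorted A'" "sorted (map fst I)" "sorted (map fst I')"
    and len: "length A \<le> length I" "length A' \<le> length I'"
      "length I' + length A = length I + length A'"
    and after: "filter (\<lambda>t. T < t) A' = filter (\<lambda>t. T < t) A"
      "filter (\<lambda>z. T < fst z) I' = filter (\<lambda>z. T < fst z) I"
      "filter (\<lambda>(J, S). T < J + S) I' = filter (\<lambda>(J, S). T < J + S) I"
    and count: "length (filter (\<lambda>z. fst z \<le> T) I) \<le> length (filter (\<lambda>t. t \<le> T) A)"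
    and tJ: "\<And>i. i < length A' \<Longrightarrow> A' ! i \<le> fst (I' ! i)"
    and S: "\<forall>(J, S)\<in>set I. 0 \<le> S" "\<forall>(J, S)\<in>set I'. 0 \<le> S"
    and feas: "feasible g I'" "length g = c" "sorted g"
  defines "zs \<equiv> zip A I" and "zs' \<equiv> zip A' I'"
  shows "lower_queue c T zs t \<unlhd> lower_queue c T' zs' t"
    and "lower_queue c T' zs' t \<unlhd> upper_queue c T' zs' t"
    and "upper_queue c T' zs' t \<unlhd> upper_queue c T zs t"
proof -
  define N where "N = length (filter (\<lambda>t. t \<le> T) A)"
  define N' where "N' = length (filter (\<lambda>t. t \<le> T) A')"
  define K where "K = filter (\<lambda>z. T < fst z) I"
  have len_A: "length A = N + length (filter (\<lambda>t. T < t) A)"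
    "length A' = N' + length (filter (\<lambda>t. T < t) A)"
    using arg_cong[OF sorted_split[of id A T], of length] sorted(1)
      arg_cong[OF sorted_split[of id A' T], of length] sorted(2) after(1)
    by (simp_all add: N_def N'_def)
  have I: "I = filter (\<lambda>z. fst z \<le> T) I @ K" "I' = filter (\<lambda>z. fst z \<le> T) I' @ K"
    using sorted_split[OF sorted(3), of T] sorted_split[OF sorted(4), of T] after(2)
    by (simp_all add: K_def)
  define n n' where "n = length (filter (\<lambda>z. fst z \<le> T) I)" "n' = length (filter (\<lambda>z. fst z \<le> T) I')"
  have "length I = n + length K" "length I' = n' + length K"
    using I unfolding n_n'_def by (metis length_append)+
  \<comment> \<open>\<open>N - n\<close> is the number of initiations after \<open>T\<close> that
    are matched with arrivals up to \<open>T\<close>. The hypothesis \<open>count\<close> keeps the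
    truncated subtraction exact.\<close>
  then have eq: "N - n = N' - n'" "n \<le> N" "n' \<le> N'"
    using len len_A count by (auto simp: N_def n_n'_def)
  have "drop N I = drop (N - n) K" "drop N' I' = drop (N' - n') K"
    using eq(2,3) by (subst I(1) I(2); simp add: n_n'_def)+
  then have drop: "drop N' I' = drop N I" using eq(1) by simp
  \<comment> \<open>The complete filtered lists agree, and so do the parts beyond positions
    \<open>N\<close> and \<open>N'\<close>; cancelling this common end leaves the initial
    parts.\<close>
  have "filter (\<lambda>(J, S). T < J + S) (take N I) = filter (\<lambda>(J, S). T < J + S) (take N' I')"
    using after(3) drop by (metis append_same_eq append_take_drop_id filter_append)
  moreover have "map snd (filter (\<lambda>(t, J, S). t \<le> T) zs) = take N I"
    "map snd (filter (\<lambda>(t, J, S). t \<le> T) zs') = take N' I'"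
    using filter_zip_sorted(1)[OF sorted(1), of T I] filter_zip_sorted(1)[OF sorted(2), of T I'] len len_A
    by (auto simp: zs_def zs'_def N_def N'_def case_prod_unfold)
  ultimately have before: "filter (\<lambda>(J, S). T < J + S) (map snd (filter (\<lambda>(t, J, S). t \<le> T) zs)) =
      filter (\<lambda>(J, S). T < J + S) (map snd (filter (\<lambda>(t, J, S). t \<le> T) zs'))"
    by simp
  have la: "list_after T zs = list_after T zs'"
    using filter_zip_sorted(2)[OF sorted(1), of T I] filter_zip_sorted(2)[OF sorted(2), of T I'] drop after(1)
    by (auto simp: zs_def zs'_def N_def N'_def case_prod_unfold list_after_def)
  have zs': "sorted (map fst zs')" "\<forall>(t, J, S)\<in>set zs'. t \<le> J \<and> 0 \<le> S"
  proof -
    show "sorted (map fst zs')" using sorted(2) by (simp add: zs'_def map_fst_zip_take sorted_wrt_take)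
    show "\<forall>(t, J, S)\<in>set zs'. t \<le> J \<and> 0 \<le> S"
    proof clarify
      fix t J S assume z: "(t, J, S) \<in> set zs'"
      then obtain i where "i < length A'" "t = A' ! i" "(J, S) = I' ! i"
        by (auto simp: zs'_def set_zip)
      then show "t \<le> J \<and> 0 \<le> S"
        using tJ[of i] S(2) len(2) nth_mem[of i I'] by (cases "I' ! i") fastforce
    qed
  qed
  have zs: "\<forall>(t, J, S)\<in>set zs. 0 \<le> S"
    using S(1) by (auto simp: zs_def dest!: set_zip_rightD)
  have "map snd zs' = take (length A') I'"
    using len(2) by (simp add: zs'_def map_snd_zip_take min_absorb1)
  then have feas': "feasible g (map snd zs')"
    using feas(1) by (metis append_take_drop_id feasible_append)
  show "lower_queue c T zs t \<unlhd> lower_queue c T' zs' t"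
    by (rule lower_queue_le_lower_queue[OF assms(1-3) zs'(1) la])
  show "lower_queue c T' zs' t \<unlhd> upper_queue c T' zs' t"
    by (rule lower_queue_le_upper_queue) (use zs'(2) in fastforce)
  show "upper_queue c T' zs' t \<unlhd> upper_queue c T zs t"
    by (rule upper_queue_le_upper_queue[OF assms(1-3) zs' zs la before feas' feas(2,3)])
qed

section \<open>Time reversal of a processor-sharing queue\<close>

fun fcfs_free :: "real \<Rightarrow> (real \<times> real) list \<Rightarrow> real" where
  "fcfs_free f [] = f"
| "fcfs_free f ((a, s) # as) = fcfs_free (max a f + s) as"

lemma fcfs_starts_append:
  "fcfs_starts f (xs @ ys) = fcfs_starts f xs @ fcfs_starts (fcfs_free f xs) ys"
  by (induction f xs rule: fcfs_free.induct) auto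

lemma length_fcfs_starts [simp]: "length (fcfs_starts f xs) = length xs"
  by (induction f xs rule: fcfs_free.induct) auto

lemma fcfs_starts_nonneg:
  assumes "\<forall>(a, s)\<in>set xs. 0 \<le> s" shows "\<forall>(J, S)\<in>set (fcfs_starts f xs). 0 \<le> S"
  using assms by (induction f xs rule: fcfs_free.induct) auto

lemma chain_fcfs_starts: "chain f (fcfs_starts f xs)"
  by (induction f xs rule: fcfs_free.induct) auto

lemma fcfs_free_ge: "\<forall>(a, s)\<in>set xs. 0 \<le> s \<Longrightarrow> f \<le> fcfs_free f xs"
  by (induction f xs rule: fcfs_free.induct) (auto intro: order_trans[rotated])

lemma fcfs_starts_le_free:
  "\<forall>(a, s)\<in>set xs. 0 \<le> s \<Longrightarrow> \<forall>(J, S)\<in>set (fcfs_starts f xs). J + S \<le> fcfs_free f xs"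
  by (induction f xs rule: fcfs_free.induct) (auto intro: fcfs_free_ge)

lemma fcfs_starts_cong:
  assumes "\<forall>(a, s)\<in>set xs. f \<le> a \<and> f' \<le> a"
  shows "fcfs_starts f xs = fcfs_starts f' xs"
proof (cases xs)
  case (Cons p xs)
  then show ?thesis using assms by (cases p) (auto simp: max_absorb1)
qed auto

text \<open>Unfolding the recursion as for Lindley's formula, the server becomes free at the maximum
  of \<open>f\<close> plus the total work and, over all customers, the arrival time plus the work
  from that customer on. Each of these terms is bounded by \<open>b\<close>.\<close>

lemma fcfs_free_le:
  assumes "f + sum_list (map snd xs) \<le> b"
    and "\<And>ys a s zs. xs = ys @ (a, s) # zs \<Longrightarrow> a + s + sum_list (map snd zs) \<le> b"
  shows "fcfs_free f xs \<le> b"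
  using assms
proof (induction f xs rule: fcfs_free.induct)
  case (2 f a s as)
  show ?case
    unfolding fcfs_free.simps
  proof (rule "2.IH")
    show "max a f + s + sum_list (map snd as) \<le> b"
      using "2.prems"(1) "2.prems"(2)[of "[]" a s as] by (auto simp: max_def)
    show "a' + s' + sum_list (map snd zs) \<le> b" if "as = ys @ (a', s') # zs" for ys a' s' zs
      using "2.prems"(2)[of "(a, s) # ys" a' s' zs] that by simp
  qed
qed auto

lemma fcfs_starts_count:
  "length (filter (\<lambda>(J, S). J \<le> x) (fcfs_starts f xs)) \<le> length (filter (\<lambda>(a, s). a \<le> x) xs)"
  by (induction f xs rule: fcfs_free.induct) (auto intro: le_SucI)

lemma length_filter_filter_le: "length (filter P (filter Q xs)) \<le> length (filter P xs)"
  by (induction xs) auto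

section \<open>Processor sharing along a fixed path\<close>

locale ps_dynamics =
  fixes q :: queue_input and r :: "nat \<Rightarrow> real \<Rightarrow> real"
  assumes finite_entries: "finite {i. entry q i \<le> t}"
    and entry_nonneg: "0 \<le> entry q i"
    and residual_pos: "0 < entry_residual q i"
    and residual_le_full: "entry_residual q i \<le> full q i"
    and ps: "processor_sharing q r"
begin

text \<open>Unlike the integrand in \<open>processor_sharing\<close>, this vanishes before the
  customer enters, so that the rates of different customers can be summed and integrated over a
  common interval.\<close>

definition rate :: "nat \<Rightarrow> real \<Rightarrow> real" where
  "rate i u = (if i \<in> present q r u then 1 / real (card (present q r u)) else 0)"

lemma finite_present: "finite (present q r u)"
  using finite_entries by (rule finite_subset[rotated]) (auto simp: present_def)

lemma sum_rate_le_1: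
  assumes "finite A" shows "(\<Sum>i\<in>A. rate i u) \<le> 1"
proof -
  have "(\<Sum>i\<in>A. rate i u) = card (A \<inter> present q r u) / card (present q r u)"
    using assms by (simp add: rate_def sum.If_cases)
  also have "\<dots> \<le> 1"
    using card_mono[OF finite_present, of "A \<inter> present q r u" u]
    by (auto simp: divide_le_eq_1)
  finally show ?thesis .
qed

lemma rate_bounds: "0 \<le> rate i u" "rate i u \<le> 1"
  using sum_rate_le_1[of "{i}" u] by (auto simp: rate_def)

lemma rate_integral_entry:
  assumes "entry q i \<le> t"
  shows "(rate i has_integral (entry_residual q i - r i t)) {entry q i..t}"
proof -
  have "((\<lambda>u. if 0 < r i u then 1 / real (card (present q r u)) else 0)
      has_integral (entry_residual q i - r i t)) {entry q i..t}"
    using ps assms by (simp add: processor_sharing_def)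
  then show ?thesis
    by (rule has_integral_eq[rotated]) (auto simp: rate_def present_def)
qed

lemma residual_entry: "r i (entry q i) = entry_residual q i"
  using rate_integral_entry[of i "entry q i"] has_integral_refl(2)[of "rate i" "entry q i"]
  by (auto dest: has_integral_unique)

lemma rate_integral:
  assumes "entry q i \<le> s" "s \<le> t"
  shows "(rate i has_integral (r i s - r i t)) {s..t}"
proof -
  have t: "(rate i has_integral (entry_residual q i - r i t)) {entry q i..t}"
    using assms by (intro rate_integral_entry) auto
  then have "rate i integrable_on {s..t}"
    using assms by (auto intro: integrable_subinterval_real)
  then obtain y where y: "(rate i has_integral y) {s..t}" by blast
  have "(rate i has_integral (entry_residual q i - r i s + y)) {entry q i..t}"
    using has_integral_combine[OF assms rate_integral_entry[OF assms(1)] y] .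
  then have "entry_residual q i - r i s + y = entry_residual q i - r i t"
    using t by (rule has_integral_unique)
  then have "y = r i s - r i t" by simp
  then show ?thesis using y by simp
qed

lemma residual_antimono: "entry q i \<le> s \<Longrightarrow> s \<le> t \<Longrightarrow> r i t \<le> r i s"
  using has_integral_nonneg[OF rate_integral] rate_bounds by force

lemma residual_lipschitz:
  assumes "entry q i \<le> s" "s \<le> t" shows "r i s - r i t \<le> t - s"
  using has_integral_le[OF rate_integral[OF assms] has_integral_const_real[of 1 s t]] rate_bounds assms
  by simp

text \<open>By continuity a negative value would be preceded by a zero. From that zero on the
  customer is no longer present, hence receives no service, and its residual stays at 0.\<close>

lemma residual_nonneg:
  assumes "entry q i \<le> t" shows "0 \<le> r i t"
proof (rule ccontr)
  assume neg: "\<not> 0 \<le> r i t"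
  have "1-lipschitz_on {entry q i..t} (r i)"
  proof (rule lipschitz_onI)
    fix x y assume "x \<in> {entry q i..t}" "y \<in> {entry q i..t}"
    then show "dist (r i x) (r i y) \<le> 1 * dist x y"
      using residual_lipschitz[of i x y] residual_lipschitz[of i y x]
        residual_antimono[of i x y] residual_antimono[of i y x]
      by (cases "x \<le> y") (auto simp: dist_real_def)
  qed simp
  then have "continuous_on {entry q i..t} (r i)"
    by (rule lipschitz_on_continuous_on)
  then obtain s where s: "entry q i \<le> s" "s \<le> t" "r i s = 0"
    using IVT2'[of "r i" t 0 "entry q i"] neg assms residual_entry residual_pos[of i] by force
  have "(rate i has_integral 0) {s..t}"
  proof (rule has_integral_is_0)
    fix u assume "u \<in> {s..t}"
    then have "r i u \<le> 0" using residual_antimono[of i s u] s by auto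
    then show "rate i u = 0" by (auto simp: rate_def present_def)
  qed
  then have "r i s - r i t = 0"
    using rate_integral[OF s(1,2)] by (auto dest: has_integral_unique)
  then show False using s neg by simp
qed

lemma residual_absorbing: "entry q i \<le> s \<Longrightarrow> s \<le> t \<Longrightarrow> r i s = 0 \<Longrightarrow> r i t = 0"
  using residual_antimono[of i s t] residual_nonneg[of i t] by simp

lemma rate_integral_before_entry:
  assumes "a \<le> entry q i" "entry q i \<le> s"
  shows "(rate i has_integral (entry_residual q i - r i s)) {a..s}"
proof -
  have "(rate i has_integral 0) (cbox a (entry q i))"
    by (rule has_integral_spike_interior[of "\<lambda>_. 0"]) (auto simp: rate_def present_def)
  then show ?thesis
    using has_integral_combine[OF assms _ rate_integral_entry[OF assms(2)], of 0] by simp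
qed

text \<open>All the work of these customers is done between \<open>a\<close> and \<open>s\<close>,
  by a server whose total rate is at most 1.\<close>

lemma work_le:
  assumes "finite A" "a \<le> s" "\<And>i. i \<in> A \<Longrightarrow> a \<le> entry q i \<and> entry q i \<le> s \<and> r i s = 0"
  shows "(\<Sum>i\<in>A. entry_residual q i) \<le> s - a"
proof -
  have "(rate i has_integral entry_residual q i) {a..s}" if "i \<in> A" for i
    using rate_integral_before_entry[of a i s] assms(3)[OF that] by simp
  then have "((\<lambda>u. \<Sum>i\<in>A. rate i u) has_integral (\<Sum>i\<in>A. entry_residual q i)) {a..s}"
    by (intro has_integral_sum assms(1))
  from has_integral_le[OF this has_integral_const_real[of 1 a s]] show ?thesis
    using sum_rate_le_1[OF assms(1)] assms(2) by simp
qed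

text \<open>While someone is present the total rate is 1, so the server completes
  \<open>t - a\<close> units of work. This cannot exceed the work of all customers that have
  entered.\<close>

lemma busy_le_work:
  assumes "a \<le> t" "\<And>u. a \<le> u \<Longrightarrow> u \<le> t \<Longrightarrow> present q r u \<noteq> {}"
  shows "t - a \<le> (\<Sum>i | entry q i \<le> t. entry_residual q i)"
proof -
  let ?A = "{i. entry q i \<le> t}"
  \<comment> \<open>Here \<open>y\<close> is the service that customer \<open>i\<close> receives
    after \<open>a\<close>; if it entered earlier, part of its work may already be done.\<close>
  have "\<exists>y\<le>entry_residual q i. (rate i has_integral y) {a..t}" if i: "entry q i \<le> t" for i
  proof (cases "a \<le> entry q i")
    case True
    have "entry_residual q i - r i t \<le> entry_residual q i" using residual_nonneg[OF i] by simp
    then show ?thesis using rate_integral_before_entry[OF True i] by blast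
  next
    case False
    then have "(rate i has_integral r i a - r i t) {a..t}" "r i a - r i t \<le> entry_residual q i"
      using rate_integral[of i a t] residual_nonneg[OF i] residual_antimono[of i "entry q i" a]
        residual_entry[of i] assms(1) by auto
    then show ?thesis by blast
  qed
  then obtain y where y: "\<And>i. i \<in> ?A \<Longrightarrow> y i \<le> entry_residual q i \<and> (rate i has_integral y i) {a..t}"
    by (metis mem_Collect_eq)
  have "1 \<le> (\<Sum>i\<in>?A. rate i u)" if "u \<in> {a..t}" for u
  proof -
    have "(\<Sum>i\<in>present q r u. rate i u) = 1"
      using assms(2)[of u] that finite_present[of u] by (simp add: rate_def)
    moreover have "(\<Sum>i\<in>present q r u. rate i u) \<le> (\<Sum>i\<in>?A. rate i u)"
      using that rate_bounds finite_entries by (intro sum_mono2) (auto simp: present_def)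
    ultimately show ?thesis by simp
  qed
  moreover have "((\<lambda>u. \<Sum>i\<in>?A. rate i u) has_integral (\<Sum>i\<in>?A. y i)) {a..t}"
    using y finite_entries by (intro has_integral_sum) auto
  ultimately have "t - a \<le> (\<Sum>i\<in>?A. y i)"
    using has_integral_le[OF has_integral_const_real[of 1 a t]] assms(1) by fastforce
  also have "\<dots> \<le> (\<Sum>i\<in>?A. entry_residual q i)"
    using y by (intro sum_mono) auto
  finally show ?thesis .
qed

end

section \<open>Emptying times and the time-reversed queue\<close>

locale ps_path = ps_dynamics +
  assumes empties: "\<exists>t\<ge>s. present q r t = {}"
    and ext_time_nonneg: "0 \<le> ext_time q k"
    and ext_dur_nonneg: "0 \<le> ext_dur q k"
begin

text \<open>The infimum is attained: a customer present there would, by the Lipschitz bound, remain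
  present for a while afterwards, although there are emptying times arbitrarily close.\<close>

lemma tau_hat:
  shows tau_hat_ge: "- T \<le> tau_hat q r T"
    and present_tau_hat: "present q r (tau_hat q r T) = {}"
proof -
  define E where "E = {t. - T \<le> t \<and> present q r t = {}}"
  have E: "E \<noteq> {}" "bdd_below E" using empties[of "- T"] by (auto simp: E_def)
  have \<tau>: "tau_hat q r T = Inf E" by (simp add: tau_hat_def E_def)
  show "- T \<le> tau_hat q r T"
    unfolding \<tau> using E(1) by (rule cInf_greatest) (simp add: E_def)
  show "present q r (tau_hat q r T) = {}"
  proof (rule ccontr)
    assume "present q r (tau_hat q r T) \<noteq> {}"
    then obtain i where i: "entry q i \<le> Inf E" "0 < r i (Inf E)"
      by (auto simp: present_def \<tau>)
    then obtain s where s: "s \<in> E" "s < Inf E + r i (Inf E)"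
      using E by (metis cInf_less_iff less_add_same_cancel1)
    have "Inf E \<le> s" using s(1) E(2) by (rule cInf_lower)
    then have "0 < r i s" "entry q i \<le> s"
      using residual_lipschitz[OF i(1), of s] s(2) i by auto
    then show False using s(1) by (auto simp: E_def present_def)
  qed
qed

lemma residual_tau_hat: "entry q i \<le> tau_hat q r T \<Longrightarrow> r i (tau_hat q r T) = 0"
  using present_tau_hat[of T] residual_nonneg[of i "tau_hat q r T"] by (auto simp: present_def)

lemma tau_hat_mono: "T' \<le> T \<Longrightarrow> tau_hat q r T \<le> tau_hat q r T'"
  unfolding tau_hat_def using empties[of "- T'"]
  by (intro cInf_superset_mono) (auto intro: bdd_belowI[of _ "- T"])

lemma departed_iff:
  "(\<exists>t. entry q i \<le> t \<and> t \<le> tau_hat q r T \<and> r i t = 0) \<longleftrightarrow> entry q i \<le> tau_hat q r T"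
  using residual_tau_hat by (auto intro: exI[of _ "tau_hat q r T"])

lemma departure:
  assumes "entry q i \<le> t" "r i t = 0"
  shows "entry q i \<le> departure q r i" "departure q r i \<le> t" "r i (departure q r i) = 0"
proof -
  define E where "E = {t. entry q i \<le> t \<and> r i t = 0}"
  have E: "t \<in> E" "bdd_below E" using assms by (auto simp: E_def)
  have d: "departure q r i = Inf E" by (simp add: departure_def E_def)
  show 1: "entry q i \<le> departure q r i"
    unfolding d using E by (intro cInf_greatest) (auto simp: E_def)
  show "departure q r i \<le> t" unfolding d using E by (rule cInf_lower)
  have "\<not> 0 < r i (Inf E)"
  proof
    assume "0 < r i (Inf E)"
    then obtain s where s: "s \<in> E" "s < Inf E + r i (Inf E)"
      using E by (metis cInf_less_iff empty_iff less_add_same_cancel1)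
    have "Inf E \<le> s" using s(1) E(2) by (rule cInf_lower)
    then show False using residual_lipschitz[of i "Inf E" s] 1 s by (auto simp: d E_def)
  qed
  then show "r i (departure q r i) = 0"
    using residual_nonneg[OF 1] by (simp add: d)
qed

lemma full_pos: "0 < full q i"
  using residual_pos[of i] residual_le_full[of i] by simp

text \<open>Only the initial customers, whose entry time is 0, can have received service before
  entry.\<close>

lemma full_eq: "0 < entry q i \<Longrightarrow> full q i = entry_residual q i"
  by (auto simp: full_def entry_residual_def entry_def split: if_splits)

definition customers :: "real \<Rightarrow> nat list" where
  "customers T = sort_key (\<lambda>i. - departure q r i) (sorted_list_of_set {i. entry q i \<le> tau_hat q r T})"

lemma reversed_arrivals_eq:
  "reversed_arrivals q r T = map (\<lambda>i. (- departure q r i, full q i)) (customers T)"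
  unfolding reversed_arrivals_def customers_def departed_iff ..

lemma customers: "set (customers T) = {i. entry q i \<le> tau_hat q r T}" "distinct (customers T)"
  using finite_entries by (auto simp: customers_def)

lemma customer_departure:
  assumes "entry q i \<le> tau_hat q r T"
  shows "entry q i \<le> departure q r i" "departure q r i \<le> tau_hat q r T" "r i (departure q r i) = 0"
  using departure[OF assms residual_tau_hat[OF assms]] by auto

lemma reversed_arrivals_bounds:
  assumes "(a, s) \<in> set (reversed_arrivals q r T)"
  shows "- tau_hat q r T \<le> a \<and> a \<le> 0 \<and> 0 \<le> s"
proof -
  obtain i where i: "entry q i \<le> tau_hat q r T" "a = - departure q r i" "s = full q i"
    using assms by (auto simp: reversed_arrivals_eq customers)
  then show ?thesis
    using customer_departure[OF i(1)] entry_nonneg[of i] full_pos[of i] by linarith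
qed

lemma filter_sorted_list_of_set:
  "finite A \<Longrightarrow> filter P (sorted_list_of_set A) = sorted_list_of_set {x \<in> A. P x}"
  for A :: "nat set"
  by (rule sorted_distinct_set_unique) (auto intro: sorted_filter[of id, simplified])

text \<open>As the queue is empty at \<open>tau_hat q r T\<close>, those who entered by then have
  left by then, and the others leave no earlier than they enter. In order of decreasing departure
  times the customers of \<open>T\<close> therefore come last, and stability of sorting preserves
  their order.\<close>

lemma customers_split:
  assumes "T' \<le> T"
  obtains xs where "customers T' = xs @ customers T" "distinct xs"
    "set xs = {i. tau_hat q r T < entry q i \<and> entry q i \<le> tau_hat q r T'}"
    "sorted (map (\<lambda>i. - departure q r i) xs)"
proof -
  define \<tau> \<tau>' where "\<tau> = tau_hat q r T" and "\<tau>' = tau_hat q r T'"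
  have \<tau>: "\<tau> \<le> \<tau>'" using tau_hat_mono[OF assms] by (simp add: \<tau>_def \<tau>'_def)
  let ?f = "\<lambda>i. - departure q r i"
  have iff: "- \<tau> \<le> ?f i \<longleftrightarrow> entry q i \<le> \<tau>" if "entry q i \<le> \<tau>'" for i
    using customer_departure[of i T] customer_departure[of i T'] that by (auto simp: \<tau>_def \<tau>'_def)
  define xs where "xs = filter (\<lambda>i. ?f i < - \<tau>) (customers T')"
  have sorted: "sorted (map ?f (customers T'))" by (simp add: customers_def)
  have "filter (\<lambda>i. \<not> ?f i < - \<tau>) (customers T') =
      sort_key ?f (filter (\<lambda>i. \<not> ?f i < - \<tau>) (sorted_list_of_set {i. entry q i \<le> \<tau>'}))"
    unfolding customers_def \<tau>'_def by (rule filter_sort)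
  also have "\<dots> = sort_key ?f (sorted_list_of_set {i. entry q i \<le> \<tau>})"
    using iff \<tau> finite_entries
    by (subst filter_sorted_list_of_set) (auto intro!: arg_cong[of _ _ "\<lambda>A. sort_key ?f (sorted_list_of_set A)"] simp: not_less)
  finally have "customers T' = xs @ customers T"
    using filter_append_filter_not[OF sorted, of "\<lambda>i. i < - \<tau>"] filter_append_filter_not[OF sorted, of "\<lambda>i. ?f i < - \<tau>"]
    by (simp add: xs_def customers_def \<tau>_def)
  moreover have "set xs = {i. \<tau> < entry q i \<and> entry q i \<le> \<tau>'}"
    using iff by (auto simp: xs_def customers \<tau>'_def[symmetric] not_le[symmetric])
  moreover have "distinct xs" "sorted (map ?f xs)"
    using sorted by (auto simp: xs_def customers sorted_filter)
  ultimately show ?thesis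
    using that by (simp add: \<tau>_def \<tau>'_def)
qed

text \<open>
  The customers that depart from the processor-sharing queue over \<open>(tau_hat q r T, s]\<close> have been
  served within this interval, which bounds their total service duration by its length. Hence the
  time-reversed queue is empty at \<open>- tau_hat q r T\<close>, wherever it is started.
\<close>

lemma fcfs_free_le_tau_hat:
  assumes "T' \<le> T" "distinct xs" "sorted (map (\<lambda>i. - departure q r i) xs)"
    and set: "set xs = {i. tau_hat q r T < entry q i \<and> entry q i \<le> tau_hat q r T'}"
    and "T < 0"
  shows "fcfs_free (- tau_hat q r T') (map (\<lambda>i. (- departure q r i, full q i)) xs) \<le> - tau_hat q r T"
proof (rule fcfs_free_le)
  define \<tau> \<tau>' where "\<tau> = tau_hat q r T" and "\<tau>' = tau_hat q r T'"
  have \<tau>: "0 < \<tau>" "\<tau> \<le> \<tau>'"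
    using tau_hat_mono[OF assms(1)] tau_hat_ge[of T] assms(5) by (auto simp: \<tau>_def \<tau>'_def)
  have full: "full q i = entry_residual q i" if "i \<in> set xs" for i
    using that \<tau>(1) by (intro full_eq) (auto simp: set \<tau>_def)
  have sum: "sum_list (map (full q) ys) = (\<Sum>i\<in>set ys. entry_residual q i)"
    if "distinct ys" "set ys \<subseteq> set xs" for ys
    using that full by (auto simp: sum_list_distinct_conv_sum_set intro!: sum.cong)
  have dep: "entry q i \<le> departure q r i" "departure q r i \<le> \<tau>'" "r i (departure q r i) = 0"
    "\<tau> < entry q i"
    if "i \<in> set xs" for i
    using that customer_departure[of i T'] by (auto simp: set \<tau>_def \<tau>'_def)
  show "- tau_hat q r T' + sum_list (map snd (map (\<lambda>i. (- departure q r i, full q i)) xs)) \<le> - tau_hat q r T"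
  proof -
    have "(\<Sum>i\<in>set xs. entry_residual q i) \<le> \<tau>' - \<tau>"
      using \<tau> dep residual_tau_hat[of _ T'] finite_set[of xs] by (intro work_le) (auto simp: set \<tau>_def \<tau>'_def)
    then show ?thesis using assms(2) by (simp add: o_def sum \<tau>_def \<tau>'_def)
  qed
  fix ys a s zs
  assume "map (\<lambda>i. (- departure q r i, full q i)) xs = ys @ (a, s) # zs"
  then obtain us i vs where xs: "xs = us @ i # vs" and a: "a = - departure q r i" "s = full q i"
    and zs: "zs = map (\<lambda>i. (- departure q r i, full q i)) vs"
    by (auto simp: map_eq_append_conv)
  \<comment> \<open>In the reversed order, customer \<open>i\<close> and those after it leave the
    processor-sharing queue no later than \<open>departure q r i\<close>, and all of them entered
    after \<open>\<tau>\<close>.\<close>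
  have "(\<Sum>k\<in>set (i # vs). entry_residual q k) \<le> departure q r i - \<tau>"
  proof (rule work_le)
    show "\<tau> \<le> departure q r i" using dep[of i] xs by auto
    fix k assume k: "k \<in> set (i # vs)"
    then have le: "departure q r k \<le> departure q r i" using assms(3) xs by (auto simp: sorted_append)
    have "k \<in> set xs" using k xs by auto
    note dep = dep[OF this]
    show "\<tau> \<le> entry q k \<and> entry q k \<le> departure q r i \<and> r k (departure q r i) = 0"
      using residual_absorbing[OF dep(1) le dep(3)] dep(1,4) le by linarith
  qed simp
  moreover have "sum_list (map (full q) (i # vs)) = (\<Sum>k\<in>set (i # vs). entry_residual q k)"
    using assms(2) xs by (intro sum) auto
  ultimately show "a + s + sum_list (map snd zs) \<le> - tau_hat q r T"
    by (simp add: a zs o_def \<tau>_def)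
qed

lemma ext_arrivals_nonneg: "(a, s) \<in> set (ext_arrivals q tp) \<Longrightarrow> 0 \<le> a \<and> 0 \<le> s"
  using ext_time_nonneg ext_dur_nonneg by (auto simp: ext_arrivals_def)

lemma durations_nonneg: "\<forall>(a, s)\<in>set (reversed_arrivals q r T @ ext_arrivals q tp). 0 \<le> s"
proof (rule ballI, clarify)
  fix a s assume "(a, s) \<in> set (reversed_arrivals q r T @ ext_arrivals q tp)"
  then show "0 \<le> s" using reversed_arrivals_bounds[of a s T] ext_arrivals_nonneg[of a s tp] by auto
qed

lemma initiations_nonneg: "(J, S) \<in> set (initiations q r T tp) \<Longrightarrow> 0 \<le> S"
  using fcfs_starts_nonneg[OF durations_nonneg, of "- tau_hat q r T" T tp]
  by (auto simp: initiations_def)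

lemma chain_initiations: "chain (- tau_hat q r T) (initiations q r T tp)"
  unfolding initiations_def
  by (rule chain_filter[OF chain_fcfs_starts fcfs_starts_nonneg[OF durations_nonneg]])

lemma initiations_count:
  assumes "x < 0"
  shows "length (filter (\<lambda>(J, S). J \<le> x) (initiations q r T tp))
    \<le> length (filter (\<lambda>(a, s). a \<le> x) (reversed_arrivals q r T))"
proof -
  let ?as = "reversed_arrivals q r T @ ext_arrivals q tp"
  have "length (filter (\<lambda>(J, S). J \<le> x) (initiations q r T tp))
      \<le> length (filter (\<lambda>(J, S). J \<le> x) (fcfs_starts (- tau_hat q r T) ?as))"
    unfolding initiations_def by (rule length_filter_filter_le)
  also have "\<dots> \<le> length (filter (\<lambda>(a, s). a \<le> x) ?as)"
    by (rule fcfs_starts_count)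
  also have "filter (\<lambda>(a, s). a \<le> x) ?as = filter (\<lambda>(a, s). a \<le> x) (reversed_arrivals q r T)"
    using ext_arrivals_nonneg assms by (force simp: filter_empty_conv)
  finally show ?thesis .
qed

text \<open>Customers still present at time 0 start by \<open>tp\<close> by assumption; the others
  satisfy \<open>J + S \<le> 0\<close> and so start by time 0. Consequently \<open>zip\<close> in
  \<open>triples\<close> drops no arrival.\<close>

lemma length_reversed_arrivals_le:
  assumes "0 \<le> tp"
    and "\<forall>(J, S)\<in>set (fcfs_starts (- tau_hat q r T) (reversed_arrivals q r T)). 0 < J + S \<longrightarrow> J \<le> tp"
  shows "length (reversed_arrivals q r T) \<le> length (initiations q r T tp)"
proof -
  have "J \<le> tp" if "(J, S) \<in> set (fcfs_starts (- tau_hat q r T) (reversed_arrivals q r T))" for J S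
    using assms that fcfs_starts_nonneg[of "reversed_arrivals q r T" "- tau_hat q r T"] reversed_arrivals_bounds
    by (cases "0 < J + S") fastforce+
  then have "filter (\<lambda>(J, S). J \<le> tp) (fcfs_starts (- tau_hat q r T) (reversed_arrivals q r T))
      = fcfs_starts (- tau_hat q r T) (reversed_arrivals q r T)"
    by (auto simp: filter_id_conv)
  then show ?thesis
    by (simp add: initiations_def fcfs_starts_append)
qed

text \<open>The server started at the earlier time is free by \<open>- tau_hat q r T\<close>, and
  all further arrivals come no earlier than that. The recursion restarts there, so both queues
  coincide from then on, and the additional services are over by
  \<open>- tau_hat q r T \<le> T\<close>.\<close>

lemma earlier_start:
  assumes "T' \<le> T" "T < 0" "0 \<le> tp"
  obtains as zs where "reversed_arrivals q r T' = as @ reversed_arrivals q r T"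
    "initiations q r T' tp = zs @ initiations q r T tp" "length zs = length as"
    "\<forall>(a, s)\<in>set as. a \<le> T" "\<forall>(J, S)\<in>set zs. J + S \<le> T \<and> 0 \<le> S"
proof -
  obtain xs where xs: "customers T' = xs @ customers T" "distinct xs"
    "set xs = {i. tau_hat q r T < entry q i \<and> entry q i \<le> tau_hat q r T'}"
    "sorted (map (\<lambda>i. - departure q r i) xs)"
    by (rule customers_split[OF assms(1)])
  define as where "as = map (\<lambda>i. (- departure q r i, full q i)) xs"
  define f where "f = - tau_hat q r T'"
  define zs where "zs = fcfs_starts f as"
  have \<tau>: "- tau_hat q r T \<le> T" using tau_hat_ge[of T] by simp
  have free: "fcfs_free f as \<le> - tau_hat q r T"
    unfolding as_def f_def using fcfs_free_le_tau_hat[OF assms(1) xs(2,4,3) assms(2)] .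
  have as: "\<forall>(a, s)\<in>set as. 0 \<le> s" using full_pos by (auto simp: as_def less_imp_le)
  have zs: "\<forall>(J, S)\<in>set zs. J + S \<le> T \<and> 0 \<le> S"
    using fcfs_starts_le_free[OF as, of f] fcfs_starts_nonneg[OF as, of f] free \<tau>
    by (fastforce simp: zs_def)
  have 1: "reversed_arrivals q r T' = as @ reversed_arrivals q r T"
    by (simp add: reversed_arrivals_eq xs(1) as_def)
  have "fcfs_starts f (reversed_arrivals q r T' @ ext_arrivals q tp) =
      zs @ fcfs_starts (fcfs_free f as) (reversed_arrivals q r T @ ext_arrivals q tp)"
    by (simp add: 1 fcfs_starts_append zs_def)
  also have "fcfs_starts (fcfs_free f as) (reversed_arrivals q r T @ ext_arrivals q tp) =
      fcfs_starts (- tau_hat q r T) (reversed_arrivals q r T @ ext_arrivals q tp)"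
  proof (rule fcfs_starts_cong)
    show "\<forall>(a, s)\<in>set (reversed_arrivals q r T @ ext_arrivals q tp).
        fcfs_free f as \<le> a \<and> - tau_hat q r T \<le> a"
      using free \<tau> assms(2) reversed_arrivals_bounds ext_arrivals_nonneg by fastforce
  qed
  moreover have "filter (\<lambda>(J, S). J \<le> tp) zs = zs"
    using zs assms(2,3) by (fastforce simp: filter_id_conv)
  ultimately have 2: "initiations q r T' tp = zs @ initiations q r T tp"
    by (simp add: initiations_def f_def)
  have "\<forall>(a, s)\<in>set as. a \<le> T"
    using customer_departure[of _ T'] \<tau> xs(3) by (fastforce simp: as_def)
  then show ?thesis
    using that[OF 1 2 _ _ zs] by (simp add: zs_def)
qed

end

section \<open>The sandwich along a fixed realization\<close>

lemma length_concat_mono: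
  assumes "\<And>j. j < c \<Longrightarrow> length (f j) \<le> length (g j)"
  shows "length (concat (map f [0..<c])) \<le> length (concat (map g [0..<c]))"
  using assms by (induction c) (simp_all add: add_mono)

lemma nth_le_iff_count:
  assumes "sorted (map f xs)" "i < length xs"
  shows "f (xs ! i) \<le> x \<longleftrightarrow> i < length (filter (\<lambda>y. f y \<le> x) xs)"
proof -
  define ys zs where "ys = filter (\<lambda>y. f y \<le> x) xs" and "zs = filter (\<lambda>y. x < f y) xs"
  have xs: "xs = ys @ zs" using sorted_split[OF assms(1)] by (simp add: ys_def zs_def)
  have "\<forall>y\<in>set ys. f y \<le> x" "\<forall>y\<in>set zs. x < f y" by (auto simp: ys_def zs_def)
  moreover have "i - length ys < length zs" if "\<not> i < length ys"
    using assms(2) that xs by (metis add_diff_inverse_nat length_append nat_add_left_cancel_less)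
  ultimately have "f ((ys @ zs) ! i) \<le> x \<longleftrightarrow> i < length ys"
    using nth_mem[of i ys] nth_mem[of "i - length ys" zs]
    by (cases "i < length ys") (auto simp: nth_append not_le)
  then show ?thesis unfolding ys_def[symmetric] using xs by simp
qed

lemma sandwich_path:
  assumes "0 < c" "T' \<le> T" "T < 0" "T \<le> t"
    and path: "\<And>j. j < c \<Longrightarrow> ps_path (q j) (r j)"
    and init: "initiated_by c q r T tp" "initiated_by c q r T' tp"
  shows "lower_process c q r tp T t \<unlhd> lower_process c q r tp T' t"
    and "lower_process c q r tp T' t \<unlhd> upper_process c q r tp T' t"
    and "upper_process c q r tp T' t \<unlhd> upper_process c q r tp T t"
proof -
  have tp: "0 \<le> tp" using init by (simp add: initiated_by_def)
  define a where "a T j = reversed_arrivals (q j) (r j) T" for T j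
  define z where "z T j = initiations (q j) (r j) T tp" for T j
  define A where "A T = sort (concat (map (\<lambda>j. map fst (a T j)) [0..<c]))" for T
  define I where "I T = sort_key fst (concat (map (z T) [0..<c]))" for T
  have triples: "triples c q r T tp = zip (A T) (I T)" for T
    by (simp add: triples_def A_def I_def a_def z_def[abs_def])
  define early where "early j as zs \<longleftrightarrow> a T' j = as @ a T j \<and> z T' j = zs @ z T j \<and> length zs = length as \<and>
      (\<forall>(a, s)\<in>set as. a \<le> T) \<and> (\<forall>(J, S)\<in>set zs. J + S \<le> T \<and> 0 \<le> S)" for j as zs
  have "\<exists>as zs. early j as zs" if "j < c" for j
    unfolding early_def a_def z_def
    by (rule ps_path.earlier_start[OF path[OF that] assms(2,3) tp]) (intro exI conjI)
  then obtain as zs where "\<And>j. j < c \<Longrightarrow> early j (as j) (zs j)"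
    by metis
  note ext = this[unfolded early_def]
  have length_a: "length (a T j) \<le> length (z T j)" "length (a T' j) \<le> length (z T' j)" if "j < c" for j
    using ps_path.length_reversed_arrivals_le[OF path[OF that] tp] init that
    unfolding initiated_by_def a_def z_def by auto
  have filter_concat_cong: "filter P (concat (map f [0..<c])) = filter P (concat (map g [0..<c]))"
    if "\<And>j. j < c \<Longrightarrow> filter P (f j) = filter P (g j)" for P :: "'c \<Rightarrow> bool" and f g
    using that by (auto simp: filter_concat o_def intro!: arg_cong[of _ _ concat])
  have count: "length (filter (\<lambda>z. fst z \<le> x) (I T)) \<le> length (filter (\<lambda>t. t \<le> x) (A T))"
    if "x < 0" for x T
    unfolding I_def A_def filter_sort length_sort filter_concat map_map o_def
  proof (rule length_concat_mono)
    fix j assume "j < c"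
    show "length (filter (\<lambda>z. fst z \<le> x) (z T j)) \<le> length (filter (\<lambda>t. t \<le> x) (map fst (a T j)))"
      using ps_path.initiations_count[OF path[OF \<open>j < c\<close>] that, of T tp]
      by (simp add: z_def a_def filter_map o_def case_prod_unfold)
  qed
  have sorted: "sorted (A T)" "sorted (map fst (I T))" for T
    by (simp_all add: A_def I_def)
  have length: "length (A T) \<le> length (I T)" "length (A T') \<le> length (I T')"
    unfolding A_def I_def length_sort
    by (intro length_concat_mono; simp add: length_a)+
  have S: "\<forall>(J, S)\<in>set (I T). 0 \<le> S" for T
    using ps_path.initiations_nonneg[OF path] by (fastforce simp: I_def z_def)
  obtain g where g: "length g = c" "sorted g" "feasible g (I T')"
  proof (rule sort_concat_feasible[of c "\<lambda>j. - tau_hat (q j) (r j) T'" "z T'"])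
    show "chain (- tau_hat (q j) (r j) T') (z T' j)" if "j < c" for j
      using ps_path.chain_initiations[OF path[OF that]] by (simp add: z_def)
    show "\<forall>(J, S)\<in>set (z T' j). 0 \<le> S" if "j < c" for j
      using ps_path.initiations_nonneg[OF path[OF that]] by (auto simp: z_def)
  qed (use that in \<open>simp add: I_def\<close>)
  have 1: "filter (\<lambda>t. T < t) (A T') = filter (\<lambda>t. T < t) (A T)"
    unfolding A_def filter_sort using ext
    by (intro arg_cong[of _ _ sort] filter_concat_cong) (force simp: filter_empty_conv)
  \<comment> \<open>The additional services are removed by the filter, which commutes with merging
    and with stable sorting.\<close>
  have 2: "filter (\<lambda>z. T < fst z) (I T') = filter (\<lambda>z. T < fst z) (I T)"
    unfolding I_def filter_sort using ext
    by (intro arg_cong[of _ _ "sort_key fst"] filter_concat_cong) (force simp: filter_empty_conv)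
  have 3: "filter (\<lambda>(J, S). T < J + S) (I T') = filter (\<lambda>(J, S). T < J + S) (I T)"
    unfolding I_def filter_sort using ext
    by (intro arg_cong[of _ _ "sort_key fst"] filter_concat_cong) (force simp: filter_empty_conv)
  have len: "length (I T') + length (A T) = length (I T) + length (A T')"
  proof -
    have "length (concat (map (z T') [0..<n])) + length (concat (map (\<lambda>j. map fst (a T j)) [0..<n])) =
        length (concat (map (z T) [0..<n])) + length (concat (map (\<lambda>j. map fst (a T' j)) [0..<n]))"
      if "n \<le> c" for n
      using that
    proof (induction n)
      case (Suc n)
      then show ?case using ext[of n] by simp
    qed simp
    then show ?thesis by (simp add: A_def I_def)
  qed
  \<comment> \<open>No single-server queue initiates more services by time \<open>x\<close> than it
    has arrivals by then, and this persists for the sums over the queues. If the \<open>i\<close>-th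
    initiation preceded the \<open>i\<close>-th arrival, the counts at the level \<open>x\<close> of
    that initiation would contradict this. Since the arrival is at or before 0, \<open>x\<close> is
    negative, as \<open>count\<close> requires.\<close>
  have tJ: "A T' ! i \<le> fst (I T' ! i)" if i: "i < length (A T')" for i
  proof (rule ccontr)
    define x where "x = fst (I T' ! i)"
    assume "\<not> A T' ! i \<le> fst (I T' ! i)"
    then have x: "x < A T' ! i" by (simp add: x_def)
    have "A T' ! i \<in> set (A T')" using i by simp
    then have "A T' ! i \<le> 0"
      using ps_path.reversed_arrivals_bounds[OF path] by (fastforce simp: A_def a_def)
    then have "length (filter (\<lambda>z. fst z \<le> x) (I T')) \<le> length (filter (\<lambda>t. t \<le> x) (A T'))"
      using x by (intro count) auto
    moreover have "i < length (filter (\<lambda>z. fst z \<le> x) (I T'))"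
      using nth_le_iff_count[OF sorted(2), of i T' x] i length(2) by (simp add: x_def)
    moreover have "\<not> i < length (filter (\<lambda>t. t \<le> x) (A T'))"
      using nth_le_iff_count[of id "A T'" i x] sorted(1)[of T'] i x by simp
    ultimately show False by simp
  qed
  have lower: "lower_process c q r tp T t = lower_queue c T (zip (A T) (I T)) t"
    and upper: "upper_process c q r tp T t = upper_queue c T (zip (A T) (I T)) t" for T
    by (simp_all add: lower_process_def upper_process_def lower_queue_def upper_queue_def triples)
  show "lower_process c q r tp T t \<unlhd> lower_process c q r tp T' t"
    "lower_process c q r tp T' t \<unlhd> upper_process c q r tp T' t"
    "upper_process c q r tp T' t \<unlhd> upper_process c q r tp T t"
    unfolding lower upper
    using sandwich[OF assms(1,2,4) sorted(1)[of T] sorted(1)[of T'] sorted(2)[of T] sorted(2)[of T']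
        length len 1 2 3 count[OF assms(3), of T] tJ S[of T] S[of T'] g(3,1,2)]
    by auto
qed

section \<open>Random walks with positive drift\<close>

context prob_space
begin

text \<open>The cross terms vanish, as each new term is centred and independent of the preceding
  sum.\<close>

lemma second_moment_sum:
  fixes Y :: "nat \<Rightarrow> 'a \<Rightarrow> real"
  assumes indep: "indep_vars (\<lambda>_. borel) Y UNIV"
    and sq: "\<And>k. integrable M (\<lambda>x. (Y k x)\<^sup>2)"
    and mean: "\<And>k. expectation (Y k) = 0" and var: "\<And>k. expectation (\<lambda>x. (Y k x)\<^sup>2) = v"
  shows "integrable M (\<lambda>x. (\<Sum>k<n. Y k x)\<^sup>2) \<and> expectation (\<lambda>x. (\<Sum>k<n. Y k x)\<^sup>2) = n * v"
proof (induction n)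
  case (Suc n)
  have rv [measurable]: "random_variable borel (Y k)" for k
    using indep by (auto simp: indep_vars_def)
  have int: "integrable M (Y k)" for k
    using square_integrable_imp_integrable[OF rv sq] .
  have S: "integrable M (\<lambda>x. \<Sum>k<n. Y k x)" using int by auto
  have "indep_var borel (Y n) borel (\<lambda>x. \<Sum>k<n. Y k x)"
    by (intro indep_vars_sum indep_vars_subset[OF indep]) auto
  note cross = indep_var_integrable[OF this int S] indep_var_lebesgue_integral[OF this int S]
  have eq: "(\<Sum>k<Suc n. Y k x)\<^sup>2 = (\<Sum>k<n. Y k x)\<^sup>2 + (Y n x)\<^sup>2 + 2 * (Y n x * (\<Sum>k<n. Y k x))" for x
    by (simp add: power2_sum algebra_simps)
  show ?case
    unfolding eq using cross Suc sq[of n] mean[of n] var[of n] by (simp add: algebra_simps)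
qed (simp add: prob_space)

lemma weak_law:
  fixes X :: "nat \<Rightarrow> 'a \<Rightarrow> real" and \<mu> m \<epsilon> :: real
  assumes indep: "indep_vars (\<lambda>_. borel) X UNIV"
    and sq: "\<And>k. integrable M (\<lambda>x. (X k x)\<^sup>2)"
    and mean: "\<And>k. expectation (X k) = \<mu>" and var: "\<And>k. expectation (\<lambda>x. (X k x)\<^sup>2) = m"
    and "0 < \<epsilon>"
  shows "(\<lambda>n. prob {x \<in> space M. \<bar>(\<Sum>k<n. X k x) - n * \<mu>\<bar> \<ge> n * \<epsilon>}) \<longlonglongrightarrow> 0"
proof -
  define Y where "Y k x = X k x - \<mu>" for k x
  have rv [measurable]: "random_variable borel (X k)" for k
    using indep by (auto simp: indep_vars_def)
  have int: "integrable M (X k)" for k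
    using square_integrable_imp_integrable[OF rv sq] .
  have "indep_vars (\<lambda>_. borel) Y UNIV"
    unfolding Y_def by (rule indep_vars_compose2[OF indep]) auto
  moreover have "integrable M (\<lambda>x. (Y k x)\<^sup>2)" "expectation (\<lambda>x. (Y k x)\<^sup>2) = m - \<mu>\<^sup>2" for k
    unfolding Y_def power2_diff using sq[of k] int[of k] mean[of k] var[of k]
    by (auto simp: prob_space power2_eq_square)
  moreover have "expectation (Y k) = 0" for k
    using int[of k] mean[of k] by (simp add: Y_def[abs_def] prob_space)
  ultimately have S: "integrable M (\<lambda>x. (\<Sum>k<n. Y k x)\<^sup>2)"
    "expectation (\<lambda>x. (\<Sum>k<n. Y k x)\<^sup>2) = n * (m - \<mu>\<^sup>2)" for n
    using second_moment_sum[of Y "m - \<mu>\<^sup>2" n] by auto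
  have eq: "(\<Sum>k<n. X k x) - n * \<mu> = (\<Sum>k<n. Y k x)" for n x
    by (simp add: Y_def sum_subtractf)
  have bound: "prob {x \<in> space M. \<bar>(\<Sum>k<n. X k x) - n * \<mu>\<bar> \<ge> n * \<epsilon>} \<le> ((m - \<mu>\<^sup>2) / \<epsilon>\<^sup>2) / n"
    if "0 < n" for n
  proof -
    have "prob {x \<in> space M. \<bar>\<Sum>k<n. Y k x\<bar> \<ge> n * \<epsilon>} \<le> n * (m - \<mu>\<^sup>2) / (n * \<epsilon>)\<^sup>2"
      using second_moment_method[OF _ S(1), of n "n * \<epsilon>"] that assms(5) S(2) by (simp add: Y_def)
    also have "\<dots> = ((m - \<mu>\<^sup>2) / \<epsilon>\<^sup>2) / n"
    proof -
      have "n * v / (n * \<epsilon>)\<^sup>2 = (v / \<epsilon>\<^sup>2) / n" for v :: real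
        using that assms(5) by (simp add: power2_eq_square field_simps)
      then show ?thesis .
    qed
    finally show ?thesis unfolding eq .
  qed
  show ?thesis
  proof (rule tendsto_sandwich[where f = "\<lambda>_. 0"])
    show "(\<lambda>n. ((m - \<mu>\<^sup>2) / \<epsilon>\<^sup>2) / real n) \<longlonglongrightarrow> 0"
      by (rule lim_const_over_n)
    show "\<forall>\<^sub>F n in sequentially. prob {x \<in> space M. \<bar>(\<Sum>k<n. X k x) - n * \<mu>\<bar> \<ge> n * \<epsilon>}
        \<le> ((m - \<mu>\<^sup>2) / \<epsilon>\<^sup>2) / n"
      using eventually_gt_at_top[of 0] by eventually_elim (rule bound)
  qed auto
qed

text \<open>If both averages lie within a third of the drift of their means, the difference at
  \<open>n\<close> exceeds \<open>n * \<epsilon>\<close>, which eventually passes \<open>K\<close>.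
  Staying below \<open>K\<close> forever thus has probability at most the sum of two deviation
  probabilities that tend to 0.\<close>

lemma difference_of_walks_unbounded:
  fixes X Y :: "nat \<Rightarrow> 'a \<Rightarrow> real" and \<mu> \<nu> m p :: real
  assumes X: "indep_vars (\<lambda>_. borel) X UNIV" "\<And>k. integrable M (\<lambda>x. (X k x)\<^sup>2)"
      "\<And>k. expectation (X k) = \<mu>" "\<And>k. expectation (\<lambda>x. (X k x)\<^sup>2) = m"
    and Y: "indep_vars (\<lambda>_. borel) Y UNIV" "\<And>k. integrable M (\<lambda>x. (Y k x)\<^sup>2)"
      "\<And>k. expectation (Y k) = \<nu>" "\<And>k. expectation (\<lambda>x. (Y k x)\<^sup>2) = p"
    and "\<nu> < \<mu>"
  shows "AE x in M. \<forall>K. \<exists>n>0. K < (\<Sum>k<n. X k x) - (\<Sum>k<n. Y k x)"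
proof -
  have rv [measurable]: "random_variable borel (X k)" "random_variable borel (Y k)" for k
    using X(1) Y(1) by (auto simp: indep_vars_def)
  define \<epsilon> where "\<epsilon> = (\<mu> - \<nu>) / 3"
  have \<epsilon>: "0 < \<epsilon>" using assms(9) by (simp add: \<epsilon>_def)
  have "AE x in M. \<exists>n>0. real K < (\<Sum>k<n. X k x) - (\<Sum>k<n. Y k x)" for K :: nat
  proof -
    define B where "B = {x \<in> space M. \<forall>n>0. (\<Sum>k<n. X k x) - (\<Sum>k<n. Y k x) \<le> K}"
    have [measurable]: "B \<in> events" unfolding B_def by measurable
    define P R where "P n = prob {x \<in> space M. \<bar>(\<Sum>k<n. X k x) - n * \<mu>\<bar> \<ge> n * \<epsilon>}"
      and "R n = prob {x \<in> space M. \<bar>(\<Sum>k<n. Y k x) - n * \<nu>\<bar> \<ge> n * \<epsilon>}" for n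
    have lim: "(\<lambda>n. P n + R n) \<longlonglongrightarrow> 0 + 0"
      unfolding P_def R_def by (intro tendsto_add weak_law[OF X \<epsilon>] weak_law[OF Y \<epsilon>])
    have "\<forall>\<^sub>F n :: nat in sequentially. K < n * \<epsilon>"
    proof -
      obtain N :: nat where "K / \<epsilon> < N" using reals_Archimedean2 by blast
      then have "K < n * \<epsilon>" if "N \<le> n" for n
        using that \<epsilon> by (auto simp: divide_less_eq intro: less_le_trans mult_right_mono)
      then show ?thesis by (auto simp: eventually_sequentially)
    qed
    then have "\<forall>\<^sub>F n in sequentially. prob B \<le> P n + R n"
      using eventually_gt_at_top[of 0]
    proof eventually_elim
      case (elim n)
      have "B \<subseteq> {x \<in> space M. \<bar>(\<Sum>k<n. X k x) - n * \<mu>\<bar> \<ge> n * \<epsilon>} \<union>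
          {x \<in> space M. \<bar>(\<Sum>k<n. Y k x) - n * \<nu>\<bar> \<ge> n * \<epsilon>}"
      proof
        fix x assume "x \<in> B"
        then have x: "x \<in> space M" "(\<Sum>k<n. X k x) - (\<Sum>k<n. Y k x) \<le> K"
          using elim by (auto simp: B_def)
        have "n * \<mu> - n * \<nu> = 3 * (n * \<epsilon>)" by (simp add: \<epsilon>_def algebra_simps)
        then show "x \<in> {x \<in> space M. \<bar>(\<Sum>k<n. X k x) - n * \<mu>\<bar> \<ge> n * \<epsilon>} \<union>
            {x \<in> space M. \<bar>(\<Sum>k<n. Y k x) - n * \<nu>\<bar> \<ge> n * \<epsilon>}"
          using x elim by (auto simp: abs_if split: if_splits)
      qed
      then have "prob B \<le> prob ({x \<in> space M. \<bar>(\<Sum>k<n. X k x) - n * \<mu>\<bar> \<ge> n * \<epsilon>} \<union>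
          {x \<in> space M. \<bar>(\<Sum>k<n. Y k x) - n * \<nu>\<bar> \<ge> n * \<epsilon>})"
        by (intro finite_measure_mono) auto
      also have "\<dots> \<le> P n + R n"
        unfolding P_def R_def by (intro measure_Un_le) auto
      finally show ?case .
    qed
    then have "prob B \<le> 0"
      using tendsto_lowerbound[OF lim] by simp
    then have "prob B = 0" using measure_nonneg[of M B] by linarith
    then have "AE x in M. x \<notin> B"
      using prob_eq_0[of B] by simp
    with AE_space show ?thesis
      by eventually_elim (auto simp: B_def not_le)
  qed
  then have "AE x in M. \<forall>K::nat. \<exists>n>0. real K < (\<Sum>k<n. X k x) - (\<Sum>k<n. Y k x)"
    by (simp add: AE_all_countable)
  then show ?thesis
  proof eventually_elim
    case (elim x)
    show ?case
    proof
      fix K :: real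
      obtain N :: nat where "K \<le> real N" using real_arch_simple by blast
      then show "\<exists>n>0. K < (\<Sum>k<n. X k x) - (\<Sum>k<n. Y k x)"
        using elim by (meson order_le_less_trans)
    qed
  qed
qed

lemma indep_sets_reindex:
  assumes "inj_on h I" "indep_sets F (h ` I)"
  shows "indep_sets (\<lambda>i. F (h i)) I"
proof (rule indep_setsI)
  show "F (h i) \<subseteq> events" if "i \<in> I" for i
    using assms(2) that by (auto simp: indep_sets_def)
  fix A J assume J: "J \<noteq> {}" "J \<subseteq> I" "finite J" "\<forall>j\<in>J. A j \<in> F (h j)"
  have inj: "inj_on h J" using assms(1) J(2) by (rule inj_on_subset)
  define A' where "A' = (\<lambda>i. A (the_inv_into J h i))"
  have A': "A' (h j) = A j" if "j \<in> J" for j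
    using the_inv_into_f_f[OF inj that] by (simp add: A'_def)
  have "prob (\<Inter>i\<in>h ` J. A' i) = (\<Prod>i\<in>h ` J. prob (A' i))"
    by (rule indep_setsD[OF assms(2)]) (use J A' in auto)
  then show "prob (\<Inter>j\<in>J. A j) = (\<Prod>j\<in>J. prob (A j))"
    using A' by (simp add: prod.reindex[OF inj])
qed

end

section \<open>Regularity of almost every path\<close>

lemma sum_entry_residual:
  "(\<Sum>i<init_num q + n. entry_residual q i) =
    (\<Sum>i<init_num q. snd (init_cust q i)) + (\<Sum>k<n. dur q k)"
proof (induction n)
  case 0
  then show ?case by (auto simp: entry_residual_def)
qed (simp add: entry_residual_def)

text \<open>The unbounded walk is used twice: it makes the entry times unbounded, so only finitely
  many customers enter by any time, and it excludes an endless busy period, in which the work done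
  would outgrow the work brought in.\<close>

lemma ps_pathI:
  assumes init: "\<And>i. i < init_num q \<Longrightarrow> 0 < snd (init_cust q i) \<and> snd (init_cust q i) \<le> fst (init_cust q i)"
    and gap: "\<And>k. 0 < gap q k" and dur: "\<And>k. 0 < dur q k"
    and ext: "\<And>k. 0 < ext_gap q k" "\<And>k. 0 < ext_dur q k"
    and ps: "processor_sharing q r"
    and walk: "\<And>K. \<exists>n>0. K < (\<Sum>k<n. gap q k) - (\<Sum>k<n. dur q k)"
  shows "ps_path q r"
proof -
  have nonneg: "0 \<le> gap q k" "0 \<le> dur q k" "0 \<le> ext_gap q k" for k
    using gap dur ext(1) by (simp_all add: less_imp_le)
  have entry: "entry q (init_num q + k) = (\<Sum>l<Suc k. gap q l)" for k
    by (simp add: entry_def lessThan_Suc_atMost)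
  have mono: "entry q i \<le> entry q j" if "i \<le> j" for i j
    using that nonneg by (auto simp: entry_def intro!: sum_mono2 sum_nonneg)
  have entry_less: "entry q (init_num q + k) < entry q (init_num q + Suc k)" for k
    unfolding entry using gap[of "Suc k"] by simp
  have set: "{i. entry q i \<le> entry q (init_num q + k)} = {..<init_num q + Suc k}" for k
  proof -
    have "i \<le> init_num q + k" if "entry q i \<le> entry q (init_num q + k)" for i
      using that entry_less[of k] mono[of "init_num q + Suc k" i] by (cases "i \<le> init_num q + k") auto
    then have iff: "entry q i \<le> entry q (init_num q + k) \<longleftrightarrow> i \<le> init_num q + k" for i
      using mono by blast
    show ?thesis unfolding iff by auto
  qed
  interpret ps_dynamics q r
  proof
    show "finite {i. entry q i \<le> t}" for t
    proof -
      obtain n where "0 < n" "t < (\<Sum>k<n. gap q k) - (\<Sum>k<n. dur q k)" using walk by blast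
      moreover have "0 \<le> (\<Sum>k<n. dur q k)" using nonneg by (simp add: sum_nonneg)
      moreover from \<open>0 < n\<close> have "entry q (init_num q + (n - 1)) = (\<Sum>k<n. gap q k)"
        unfolding entry by simp
      ultimately have "t < entry q (init_num q + (n - 1))" by linarith
      then have "{i. entry q i \<le> t} \<subseteq> {i. entry q i \<le> entry q (init_num q + (n - 1))}" by auto
      then show ?thesis unfolding set by (rule finite_subset) simp
    qed
    show "0 \<le> entry q i" for i
      using nonneg by (simp add: entry_def sum_nonneg)
    show "0 < entry_residual q i" "entry_residual q i \<le> full q i" for i
      using init dur by (auto simp: entry_residual_def full_def)
  qed (rule ps)
  show ?thesis
  proof
    show "\<exists>t\<ge>s. present q r t = {}" for s
    proof (rule ccontr)
      assume busy: "\<not> ?thesis"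
      define a where "a = max s 0"
      define b where "b = (\<Sum>i<init_num q. snd (init_cust q i))"
      have b: "0 \<le> b" unfolding b_def using init by (intro sum_nonneg) force
      \<comment> \<open>The level \<open>a + b\<close> compensates for the time before
        \<open>a\<close> and for the initial work \<open>b\<close>.\<close>
      obtain n where n: "0 < n" "a + b < (\<Sum>k<n. gap q k) - (\<Sum>k<n. dur q k)" using walk by blast
      then obtain k where k: "n = Suc k" by (cases n) auto
      define t where "t = entry q (init_num q + k)"
      have t: "t = (\<Sum>l<n. gap q l)" by (simp add: t_def entry k)
      have "0 \<le> (\<Sum>k<n. dur q k)" using nonneg by (simp add: sum_nonneg)
      then have "a \<le> t" using n(2) t b by linarith
      then have "t - a \<le> (\<Sum>i | entry q i \<le> t. entry_residual q i)"
        using busy by (intro busy_le_work) (auto simp: a_def)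
      also have "\<dots> = b + (\<Sum>k<n. dur q k)"
        unfolding t_def set sum_entry_residual by (simp add: b_def k)
      finally show False using n(2) t by linarith
    qed
    show "0 \<le> ext_time q k" for k
      using nonneg by (simp add: ext_time_def sum_nonneg)
    show "0 \<le> ext_dur q k" for k
      using ext(2) by (simp add: less_imp_le)
  qed
qed

lemma (in prob_space) indep_vars_vimage_algebra:
  assumes "indep_sets F J" "inj_on h I" "h ` I \<subseteq> J"
    and F: "\<And>i. i \<in> I \<Longrightarrow> F (h i) = sets (vimage_algebra (space M) (X i) borel)"
    and X: "\<And>i. i \<in> I \<Longrightarrow> random_variable borel (X i)"
  shows "indep_vars (\<lambda>_. borel) X I"
  unfolding indep_vars_def2
proof (intro conjI ballI X)
  have "indep_sets (\<lambda>i. F (h i)) I"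
    by (rule indep_sets_reindex[OF assms(2) indep_sets_mono_index[OF assms(3,1)]])
  then show "indep_sets (\<lambda>i. {X i -` A \<inter> space M |A. A \<in> sets borel}) I"
    by (rule indep_sets_mono_sets) (auto simp: F sets_vimage_algebra2)
qed

lemma (in prob_space) exponential_distributed_pos:
  assumes "0 < l" "distributed M lborel X (exponential_density l)"
  shows "AE x in M. 0 < X x"
proof -
  have [measurable]: "random_variable borel X"
    using distributed_measurable[OF assms(2)] by simp
  have "prob {x \<in> space M. 0 < X x} = 1"
    using exponential_distributedD_gt[OF assms(2), of 0] assms(1) by simp
  then show ?thesis by (subst (asm) prob_Collect_eq_1) auto
qed

context dominating_process
begin

lemma AE_ps_path:
  assumes "0 < lam" and G: "prob_space G" "sets G = sets borel" "AE s in G. 0 < s"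
    and "integrable G (\<lambda>s. s\<^sup>2)" "lam * (LINT s|G. s) < real c" and "j < c"
  shows "AE \<omega> in M. ps_path (Q j \<omega>) (\<lambda>i t. r j i t \<omega>)"
proof -
  define l where "l = lam / real c"
  have l: "0 < l" using assms(1,7) by (simp add: l_def)
  note gap = gap_law[OF assms(7), folded l_def] and ext_gap = ext_gap_law[OF assms(7), folded l_def]
  have gap_m [measurable]: "random_variable borel (\<lambda>\<omega>. gap (Q j \<omega>) k)" for k
    using distributed_measurable[OF gap] by simp
  note [measurable] = dur_measurable[OF assms(7)]
  have walk: "AE \<omega> in M. \<forall>K. \<exists>n>0. K < (\<Sum>k<n. gap (Q j \<omega>) k) - (\<Sum>k<n. dur (Q j \<omega>) k)"
  proof (rule difference_of_walks_unbounded)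
    show "indep_vars (\<lambda>_. borel) (\<lambda>k \<omega>. gap (Q j \<omega>) k) UNIV"
      using assms(7) by (intro indep_vars_vimage_algebra[OF independent, of "Gap j"]) (auto simp: inj_on_def)
    show "indep_vars (\<lambda>_. borel) (\<lambda>k \<omega>. dur (Q j \<omega>) k) UNIV"
      using assms(7) by (intro indep_vars_vimage_algebra[OF independent, of "Dur j"]) (auto simp: inj_on_def)
    show "integrable M (\<lambda>\<omega>. (gap (Q j \<omega>) k)\<^sup>2)" for k
      by (rule erlang_ith_moment_integrable[OF l gap])
    show "expectation (\<lambda>\<omega>. gap (Q j \<omega>) k) = 1 / l" for k
      using erlang_ith_moment[OF l gap[of k], of 1] by simp
    show "expectation (\<lambda>\<omega>. (gap (Q j \<omega>) k)\<^sup>2) = 2 / l\<^sup>2" for k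
      using erlang_ith_moment[OF l gap[of k], of 2] by simp
    show "integrable M (\<lambda>\<omega>. (dur (Q j \<omega>) k)\<^sup>2)" for k
      using assms(5) unfolding dur_law[OF assms(7), of k, symmetric] by (subst (asm) integrable_distr_eq) auto
    show "expectation (\<lambda>\<omega>. dur (Q j \<omega>) k) = (LINT s|G. s)" for k
      unfolding dur_law[OF assms(7), of k, symmetric] by (subst integral_distr) auto
    show "expectation (\<lambda>\<omega>. (dur (Q j \<omega>) k)\<^sup>2) = (LINT s|G. s\<^sup>2)" for k
      unfolding dur_law[OF assms(7), of k, symmetric] by (subst integral_distr) auto
    \<comment> \<open>Stability of the whole system amounts to stability of each queue: the mean
      duration is below the mean interarrival time \<open>c / lam\<close>.\<close>
    show "(LINT s|G. s) < 1 / l"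
      using assms(1,6,7) by (simp add: l_def field_simps)
  qed
  have pos: "AE \<omega> in M. 0 < X \<omega>" if "random_variable borel X" "distr M borel X = G" for X
  proof -
    have "AE s in distr M borel X. 0 < s" unfolding that(2) by (rule G(3))
    then show ?thesis using that(1) by (subst (asm) AE_distr_iff) auto
  qed
  have "AE \<omega> in M. \<forall>k. 0 < gap (Q j \<omega>) k" "AE \<omega> in M. \<forall>k. 0 < ext_gap (Q j \<omega>) k"
    "AE \<omega> in M. \<forall>k. 0 < dur (Q j \<omega>) k" "AE \<omega> in M. \<forall>k. 0 < ext_dur (Q j \<omega>) k"
    unfolding AE_all_countable
    by (intro allI exponential_distributed_pos[OF l gap] exponential_distributed_pos[OF l ext_gap]
        pos[OF dur_measurable[OF assms(7)] dur_law[OF assms(7)]]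
        pos[OF ext_dur_measurable[OF assms(7)] ext_dur_law[OF assms(7)]])+
  with walk init_residual[OF assms(7)] ps_dynamics[OF assms(7)] show ?thesis
    by eventually_elim (rule ps_pathI; blast)
qed

end

theorem theorem5p1:
  fixes M :: "'w measure" and c :: nat and lam :: real and G :: "real measure"
    and Q :: "nat \<Rightarrow> 'w \<Rightarrow> queue_input" and r :: "nat \<Rightarrow> nat \<Rightarrow> real \<Rightarrow> 'w \<Rightarrow> real"
    and T T' :: real
  assumes "1 \<le> c" and "0 < lam"
    and "prob_space G" and "sets G = sets borel" and "AE s in G. 0 < s"
    and "integrable G (\<lambda>s. s\<^sup>2)" and "lam * (LINT s|G. s) < real c"
    and "dominating_process M c lam G Q r"
    and "T' < T" and "T < 0"
  shows "AE \<omega> in M. \<forall>tp.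
    (let q = (\<lambda>j. Q j \<omega>); \<rho> = (\<lambda>j i u. r j i u \<omega>) in
      initiated_by c q \<rho> T tp \<and> initiated_by c q \<rho> T' tp \<longrightarrow>
      (\<forall>t\<in>{T..0}.
         lower_process c q \<rho> tp T t \<unlhd> lower_process c q \<rho> tp T' t \<and>
         lower_process c q \<rho> tp T' t \<unlhd> upper_process c q \<rho> tp T' t \<and>
         upper_process c q \<rho> tp T' t \<unlhd> upper_process c q \<rho> tp T t))"
proof -
  interpret dominating_process M c lam G Q r by fact
  \<comment> \<open>The finitely many exceptional null sets depend neither on \<open>tp\<close> nor
    on the time \<open>t\<close>, so the pathwise result applies to all of these
    simultaneously.\<close>
  have "AE \<omega> in M. \<forall>j\<in>{..<c}. ps_path (Q j \<omega>) (\<lambda>i t. r j i t \<omega>)"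
    by (intro AE_finite_allI AE_ps_path assms) auto
  then show ?thesis
  proof eventually_elim
    case (elim \<omega>)
    have "0 < c" "T' \<le> T" using assms(1,9) by auto
    with elim show ?case
      using sandwich_path[of c T' T _ "\<lambda>j. Q j \<omega>" "\<lambda>j i u. r j i u \<omega>"] assms(10)
      by (auto simp: Let_def)
  qed
qed

end
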